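(* Let $G$ be an $s$-$t$ graph with $|V(G)|>2$, $\mathsf d_G$ a normalized geodesic metric on $V(G)$ (i.e. $\mathsf d_G(s(G),t(G))=1$), and $\nu_G$ a fully supported probability measure on $E(G)$. The following are equivalent: 1. For all $n\in\mathbb N$, $G^{\oslash n}$ has $(\mu(\nu_G^{\oslash n}),\nu_G^{\oslash n},\mathsf d_G^{\oslash n})$-isoperimetric dimension $\displaystyle\delta=\max_{e\in E(G)}\frac{\log(\nu_G(e))}{\log(\mathsf d_G(e))}$ with constant $\displaystyle C\le\max_{\emptyset\ne S\subsetneq V(G)}\mathrm{Per}_{\nu_G,\mathsf d_G}(S)^{-1}$. 2. There exist $\delta\in[1,\infty)$ and $C\in(0,\infty)$ such that, for all $n\in\mathbb N$, $G^{\oslash n}$ has $(\mu(\nu_G^{\oslash n}),\nu_G^{\oslash n},\mathsf d_G^{\oslash n})$-isoperimetric dimension $\delta$ with constant $C$. 3. $\displaystyle\min_{\substack{S\subset V(G)\\|S\cap\{s(G),t(G)\}|=1}}\mathrm{Per}_{\nu_G,\mathsf d_G}(S)\ge1$.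
   Context: **Graphs.** Graphs are finite, connected, directed, with at least one edge, without self-loops or multiple edges between the same pair of vertices. For $e=(u,v)\in E(G)$, $e^-=u$, $e^+=v$. A metric $\mathsf d$ on $V(G)$ is geodesic if any $x,y$ are joined by a path (edges traversed in either direction) $u_0=x,\dots,u_k=y$ with $\mathsf d(x,y)=\sum_i\mathsf d(u_{i-1},u_i)$; $\mathsf d(e)=\mathsf d(e^-,e^+)$. An $s$-$t$ graph is a graph $G$ with two distinct distinguished vertices, a source $s(G)$ and a sink $t(G)$, and an orientation of the edges such that every vertex belongs to a directed path from $s(G)$ to $t(G)$. **$\oslash$-products and powers.** For a graph $H$ and an $s$-$t$ graph $G$, $V(H\oslash G)=E(H)\times V(G)/\sim$, where $(e_1,u_1)\sim(e_2,u_2)$ iff they are equal, or $u_1,u_2\in\{s(G),t(G)\}$ and the corresponding endpoints in $H$ coincide ($(e,s(G))$ corresponds to $e^-$, $(e,t(G))$ to $e^+$). The class of $(e,u)$ is $e\oslash u$; the edges are $e\oslash f:=(e\oslash f^-,e\oslash f^+)$, $(e,f)\in E(H)\times E(G)$. If $H$ is an $s$-$t$ graph then so is $H\oslash G$, with source and sink those of $H$ (viewing $V(H)\subset V(H\oslash G)$ via $e^-\mapsto e\oslash s(G)$, $e^+\mapsto e\oslash t(G)$). $(\nu_H\oslash\nu_G)(e\oslash f)=\nu_H(e)\nu_G(f)$, and $\mathsf d_H\oslash\mathsf d_G$ is the unique geodesic metric on $V(H\oslash G)$ with $(\mathsf d_H\oslash\mathsf d_G)(e\oslash f)=\mathsf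 d_H(e)\mathsf d_G(f)$. $G^{\oslash1}=G$, $G^{\oslash(n+1)}=G^{\oslash n}\oslash G$; likewise for $\nu_G^{\oslash n}$, $\mathsf d_G^{\oslash n}$. **Induced vertex measure.** For a measure $\nu$ on the edge set, $\mu(\nu)(x)=\frac12\sum_{e:\,x\in\{e^-,e^+\}}\nu(e)$. **Isoperimetric dimension.** A graph $K$ with probability measures $\mu$ on $V(K)$, $\nu$ on $E(K)$ and geodesic metric $\mathsf d$ on $V(K)$ has $(\mu,\nu,\mathsf d)$-isoperimetric dimension $\delta\in[1,\infty)$ with constant $C\in(0,\infty)$ if for every $A\subset V(K)$, $\min\{\mu(A),\mu(A^c)\}^{\frac{\delta-1}{\delta}}\le C\,\mathrm{Per}_{\nu,\mathsf d}(A)$, where $\partial_KA=\{(x,y)\in E(K):|\{x,y\}\cap A|=1\}$ and $\mathrm{Per}_{\nu,\mathsf d}(A)=\sum_{e\in\partial_KA}\frac{\nu(e)}{\mathsf d(e)}$.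
   Formalization: The formal statement assumes d_G(e) ≠ 1 for every edge e: otherwise δ divides by log 1 = 0, and 3 does not imply 2 (triangle s,u,t with lengths 1, 1/2, 1/2 and ν_G = 1/3 on each edge). For δ = 1, 0^0 is read as 0. *)

theory Defs
  imports
    "HOL-Analysis.Analysis"
    "HOL-Library.FSet"
    "Graph_Theory.Graph_Theory"
begin

text \<open>
  Finite connected directed graphs with at least one edge, no self-loops and at most one edge
  between two given vertices. The last condition excludes antiparallel edges too:
  otherwise the edges of the product below would not be indexed by pairs of edges.
\<close>

definition simple_graph :: "'a pair_pre_digraph \<Rightarrow> bool" where
  "simple_graph G \<longleftrightarrow>
     pair_digraph G \<and> connected (with_proj G) \<and> parcs G \<noteq> {} \<and>
     (\<forall>u v. (u, v) \<in> parcs G \<longrightarrow> (v, u) \<notin> parcs G)"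

definition st_graph :: "'a pair_pre_digraph \<Rightarrow> 'a \<Rightarrow> 'a \<Rightarrow> bool" where
  "st_graph G s t \<longleftrightarrow>
     simple_graph G \<and> s \<in> pverts G \<and> t \<in> pverts G \<and> s \<noteq> t \<and>
     (\<forall>v\<in>pverts G. \<exists>p. vwalk p (with_proj G) \<and> hd p = s \<and> last p = t \<and> v \<in> set p)"

text \<open>
  The locale \<open>Metric_space\<close> also asks for symmetry and nonnegativity off the carrier;
  every metric on the vertex set extends to such a function.
\<close>

definition geodesic_metric :: "'a pair_pre_digraph \<Rightarrow> ('a \<Rightarrow> 'a \<Rightarrow> real) \<Rightarrow> bool" where
  "geodesic_metric G d \<longleftrightarrow>
     Metric_space (pverts G) d \<and>
     (\<forall>x\<in>pverts G. \<forall>y\<in>pverts G. \<exists>p.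
        vwalk p (with_proj (mk_symmetric (with_proj G))) \<and> hd p = x \<and> last p = y \<and>
        d x y = (\<Sum>(u, v)\<leftarrow>vwalk_arcs p. d u v))"

text \<open>
  The gluing relation on \<open>E(H) \<times> V(G)\<close>, where \<open>s\<close> and \<open>t\<close> are the source and sink of \<open>G\<close>.
\<close>

definition endpoint :: "'a \<Rightarrow> 'b \<times> 'b \<Rightarrow> 'a \<Rightarrow> 'b" where
  "endpoint s e u = (if u = s then fst e else snd e)"

definition oslash_rel ::
  "'b pair_pre_digraph \<Rightarrow> 'a pair_pre_digraph \<Rightarrow> 'a \<Rightarrow> 'a \<Rightarrow> (('b \<times> 'b) \<times> 'a) rel" where
  "oslash_rel H G s t =
     {((e1, u1), (e2, u2)).
        e1 \<in> parcs H \<and> u1 \<in> pverts G \<and> e2 \<in> parcs H \<and> u2 \<in> pverts G \<and>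
        ((e1, u1) = (e2, u2) \<or>
         u1 \<in> {s, t} \<and> u2 \<in> {s, t} \<and> endpoint s e1 u1 = endpoint s e2 u2)}"

text \<open>
  The vertices of a product are finite equivalence classes, so the vertex type would change with
  every product. The following type contains copies of the vertices of \<open>G\<close> and is closed under
  forming classes, and therefore contains the vertices of all powers of \<open>G\<close>.
\<close>

datatype 'a pvertex =
    Base (unbase: 'a)
  | Cls "(('a pvertex \<times> 'a pvertex) \<times> 'a) fset"

definition oslash_vertex ::
  "'a pvertex pair_pre_digraph \<Rightarrow> 'a pair_pre_digraph \<Rightarrow> 'a \<Rightarrow> 'a \<Rightarrow>
   'a pvertex \<times> 'a pvertex \<Rightarrow> 'a \<Rightarrow> 'a pvertex" where
  "oslash_vertex H G s t e u = Cls (Abs_fset (oslash_rel H G s t `` {(e, u)}))"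

definition oslash_edge ::
  "'a pvertex pair_pre_digraph \<Rightarrow> 'a pair_pre_digraph \<Rightarrow> 'a \<Rightarrow> 'a \<Rightarrow>
   'a pvertex \<times> 'a pvertex \<Rightarrow> 'a \<times> 'a \<Rightarrow> 'a pvertex \<times> 'a pvertex" where
  "oslash_edge H G s t e f =
     (oslash_vertex H G s t e (fst f), oslash_vertex H G s t e (snd f))"

definition oslash ::
  "'a pvertex pair_pre_digraph \<Rightarrow> 'a pair_pre_digraph \<Rightarrow> 'a \<Rightarrow> 'a \<Rightarrow> 'a pvertex pair_pre_digraph"
  where
  "oslash H G s t =
     \<lparr> pverts = {oslash_vertex H G s t e u | e u. e \<in> parcs H \<and> u \<in> pverts G},
       parcs = {oslash_edge H G s t e f | e f. e \<in> parcs H \<and> f \<in> parcs G} \<rparr>"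

text \<open>
  Since \<open>(e, f)\<close> is determined by the edge it gives rise to, the sum has exactly one term
  on each edge of the product.
\<close>

definition oslash_measure ::
  "'a pvertex pair_pre_digraph \<Rightarrow> 'a pair_pre_digraph \<Rightarrow> 'a \<Rightarrow> 'a \<Rightarrow>
   ('a pvertex \<times> 'a pvertex \<Rightarrow> real) \<Rightarrow> ('a \<times> 'a \<Rightarrow> real) \<Rightarrow>
   ('a pvertex \<times> 'a pvertex \<Rightarrow> real)" where
  "oslash_measure H G s t \<nu>H \<nu>G x =
     (\<Sum>(e, f) | e \<in> parcs H \<and> f \<in> parcs G \<and> oslash_edge H G s t e f = x. \<nu>H e * \<nu>G f)"

text \<open>
  Metrics are functions on the whole vertex type; fixing the value off the vertex set
  makes the metric unique as a function.
\<close>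

definition oslash_metric ::
  "'a pvertex pair_pre_digraph \<Rightarrow> 'a pair_pre_digraph \<Rightarrow> 'a \<Rightarrow> 'a \<Rightarrow>
   ('a pvertex \<Rightarrow> 'a pvertex \<Rightarrow> real) \<Rightarrow> ('a \<Rightarrow> 'a \<Rightarrow> real) \<Rightarrow>
   ('a pvertex \<Rightarrow> 'a pvertex \<Rightarrow> real)" where
  "oslash_metric H G s t dH dG =
     (THE d. geodesic_metric (oslash H G s t) d \<and>
        (\<forall>e\<in>parcs H. \<forall>f\<in>parcs G.
           d (oslash_vertex H G s t e (fst f)) (oslash_vertex H G s t e (snd f)) =
             dH (fst e) (snd e) * dG (fst f) (snd f)) \<and>
        (\<forall>x y. x \<notin> pverts (oslash H G s t) \<or> y \<notin> pverts (oslash H G s t) \<longrightarrow> d x y = 0))"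

text \<open>
  Exponents are shifted by one: index \<open>n\<close> stands for the power with exponent \<open>n + 1\<close>.
  Thus index \<open>0\<close> is (a copy of) \<open>G\<close> itself, and all \<open>n :: nat\<close> give all exponents \<open>\<ge> 1\<close>.
\<close>

primrec oslash_power :: "'a pair_pre_digraph \<Rightarrow> 'a \<Rightarrow> 'a \<Rightarrow> nat \<Rightarrow> 'a pvertex pair_pre_digraph" where
  "oslash_power G s t 0 = \<lparr> pverts = Base ` pverts G, parcs = map_prod Base Base ` parcs G \<rparr>"
| "oslash_power G s t (Suc n) = oslash (oslash_power G s t n) G s t"

primrec measure_power ::
  "'a pair_pre_digraph \<Rightarrow> 'a \<Rightarrow> 'a \<Rightarrow> ('a \<times> 'a \<Rightarrow> real) \<Rightarrow> nat \<Rightarrow>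
   ('a pvertex \<times> 'a pvertex \<Rightarrow> real)" where
  "measure_power G s t \<nu> 0 = (\<lambda>e. \<nu> (map_prod unbase unbase e))"
| "measure_power G s t \<nu> (Suc n) =
     oslash_measure (oslash_power G s t n) G s t (measure_power G s t \<nu> n) \<nu>"

primrec metric_power ::
  "'a pair_pre_digraph \<Rightarrow> 'a \<Rightarrow> 'a \<Rightarrow> ('a \<Rightarrow> 'a \<Rightarrow> real) \<Rightarrow> nat \<Rightarrow>
   ('a pvertex \<Rightarrow> 'a pvertex \<Rightarrow> real)" where
  "metric_power G s t d 0 = (\<lambda>x y. d (unbase x) (unbase y))"
| "metric_power G s t d (Suc n) =
     oslash_metric (oslash_power G s t n) G s t (metric_power G s t d n) d"

definition full_prob_measure :: "'b set \<Rightarrow> ('b \<Rightarrow> real) \<Rightarrow> bool" where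
  "full_prob_measure E \<nu> \<longleftrightarrow> (\<forall>e\<in>E. \<nu> e > 0) \<and> sum \<nu> E = 1"

definition vertex_measure :: "'b pair_pre_digraph \<Rightarrow> ('b \<times> 'b \<Rightarrow> real) \<Rightarrow> 'b \<Rightarrow> real" where
  "vertex_measure K \<nu> x = 1 / 2 * (\<Sum>e | e \<in> parcs K \<and> x \<in> {fst e, snd e}. \<nu> e)"

definition edge_boundary :: "'b pair_pre_digraph \<Rightarrow> 'b set \<Rightarrow> ('b \<times> 'b) set" where
  "edge_boundary K A = {(x, y) \<in> parcs K. card ({x, y} \<inter> A) = 1}"

definition perimeter ::
  "'b pair_pre_digraph \<Rightarrow> ('b \<times> 'b \<Rightarrow> real) \<Rightarrow> ('b \<Rightarrow> 'b \<Rightarrow> real) \<Rightarrow> 'b set \<Rightarrow> real" where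
  "perimeter K \<nu> d A = (\<Sum>e\<in>edge_boundary K A. \<nu> e / d (fst e) (snd e))"

text \<open>
  Note that \<open>0 powr 0 = 0\<close>. For \<open>\<delta> = 1\<close> this makes the inequality trivial
  when \<open>A\<close> or its complement is empty, as it is for \<open>\<delta> > 1\<close>.
\<close>

definition has_isoperimetric_dimension ::
  "'b pair_pre_digraph \<Rightarrow> ('b \<Rightarrow> real) \<Rightarrow> ('b \<times> 'b \<Rightarrow> real) \<Rightarrow> ('b \<Rightarrow> 'b \<Rightarrow> real) \<Rightarrow>
   real \<Rightarrow> real \<Rightarrow> bool" where
  "has_isoperimetric_dimension K \<mu> \<nu> d \<delta> C \<longleftrightarrow>
     1 \<le> \<delta> \<and> 0 < C \<and>
     (\<forall>A\<subseteq>pverts K.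
        min (sum \<mu> A) (sum \<mu> (pverts K - A)) powr ((\<delta> - 1) / \<delta>) \<le> C * perimeter K \<nu> d A)"

text \<open>As above, index \<open>n\<close> stands for exponent \<open>n + 1\<close>.\<close>

definition power_has_isoperimetric_dimension ::
  "'a pair_pre_digraph \<Rightarrow> 'a \<Rightarrow> 'a \<Rightarrow> ('a \<times> 'a \<Rightarrow> real) \<Rightarrow> ('a \<Rightarrow> 'a \<Rightarrow> real) \<Rightarrow>
   nat \<Rightarrow> real \<Rightarrow> real \<Rightarrow> bool" where
  "power_has_isoperimetric_dimension G s t \<nu> d n \<delta> C \<longleftrightarrow>
     has_isoperimetric_dimension (oslash_power G s t n)
       (vertex_measure (oslash_power G s t n) (measure_power G s t \<nu> n))
       (measure_power G s t \<nu> n) (metric_power G s t d n) \<delta> C"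

lemma equiv_oslash_rel:
  assumes "\<And>e. e \<in> parcs H \<Longrightarrow> fst e \<noteq> snd e"
  shows "equiv (parcs H \<times> pverts G) (oslash_rel H G s t)"
  by (rule equivI) (auto simp: oslash_rel_def refl_on_def sym_def trans_def)

lemma oslash_vertex_eq_iff:
  assumes "finite (parcs H)" "finite (pverts G)" "\<And>e. e \<in> parcs H \<Longrightarrow> fst e \<noteq> snd e"
    and "e1 \<in> parcs H" "u1 \<in> pverts G" "e2 \<in> parcs H" "u2 \<in> pverts G"
  shows "oslash_vertex H G s t e1 u1 = oslash_vertex H G s t e2 u2 \<longleftrightarrow>
         ((e1, u1), (e2, u2)) \<in> oslash_rel H G s t"
proof -
  have eq: "equiv (parcs H \<times> pverts G) (oslash_rel H G s t)"
    using assms(3) by (rule equiv_oslash_rel)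
  have fin: "finite (oslash_rel H G s t `` {x})" for x
    by (rule finite_subset[of _ "parcs H \<times> pverts G"]) (auto simp: oslash_rel_def assms(1,2))
  have "oslash_vertex H G s t e1 u1 = oslash_vertex H G s t e2 u2 \<longleftrightarrow>
        oslash_rel H G s t `` {(e1, u1)} = oslash_rel H G s t `` {(e2, u2)}"
    using fin by (simp add: oslash_vertex_def Abs_fset_inject)
  also have "\<dots> \<longleftrightarrow> ((e1, u1), (e2, u2)) \<in> oslash_rel H G s t"
    using eq assms(4-7) by (simp add: eq_equiv_class_iff)
  finally show ?thesis .
qed

end

(*
  Cutting the vertex set of the product of H and G into copies of G shows that the perimeter of a
  set A is the sum over e in E(H) of nu(e)/d(e) times the perimeter of the trace of A on the copy e.

  (3) ==> (1): By induction, every set that separates s from t in a power has perimeter at least 1,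
  so the perimeter of A is at least that of its trace on V(G) in the decomposition of a power as G
  times a smaller power. If that trace is nontrivial, this bounds the perimeter by a constant.
  Otherwise A or its complement misses s and t in all copies, and the induction hypothesis applies
  to each copy, because nu(e)/d(e) >= nu(e)^theta with theta = (delta-1)/delta and x^theta is
  subadditive. That d(e) < 1 and delta >= 1 follows from (3) by averaging over the balls around s.

  (2) ==> (3): If a separating S has perimeter p < 1, a set that contains an edge and misses an edge
  can be refined repeatedly by copies of S and of its complement: its perimeter decays like p^n,
  whereas its mass and that of its complement stay bounded away from 0.
*)
theory Submission
  imports Defs
begin

section \<open>Path metrics\<close>

text \<open>The metric of a product is a definite description, so the prescribed lengths must first
  be shown to come from exactly one geodesic metric. On a finite connected graph, shortest walks
  give a metric for any positive symmetric lengths; the obstacle is a detour that is shorter than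
  the edge it bypasses. A Lipschitz function that attains the length of this edge rules such a
  detour out, and in a product d(s,t) = 1 makes it possible to build one.

  No edge of G has length 1, so s and t are not adjacent. Hence an edge of a product determines its
  cell, and sums over the edges split into sums over the cells.

  The constant is the same for all powers because each branch of the recursion pays it at most once:
  as long as the traces are trivial, entering a cell of weight nu scales mass^theta by nu^theta and
  the perimeter by at least as much; the first nontrivial trace ends the descent, since no mass
  exceeds 1.\<close>

abbreviation sym_arcs :: "'a pair_pre_digraph \<Rightarrow> ('a \<times> 'a) set" where
  "sym_arcs K \<equiv> parcs K \<union> (parcs K)\<inverse>"

definition walk_between :: "'a pair_pre_digraph \<Rightarrow> 'a \<Rightarrow> 'a \<Rightarrow> 'a list \<Rightarrow> bool" where
  "walk_between K x y p \<longleftrightarrow>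
     vwalk p (with_proj (mk_symmetric (with_proj K))) \<and> hd p = x \<and> last p = y"

definition walk_length :: "('a \<Rightarrow> 'a \<Rightarrow> real) \<Rightarrow> 'a list \<Rightarrow> real" where
  "walk_length l p = (\<Sum>(u, v)\<leftarrow>vwalk_arcs p. l u v)"

lemma geodesic_metric_walk:
  "geodesic_metric K d \<longleftrightarrow>
     Metric_space (pverts K) d \<and>
     (\<forall>x\<in>pverts K. \<forall>y\<in>pverts K. \<exists>p. walk_between K x y p \<and> d x y = walk_length d p)"
  by (simp add: geodesic_metric_def walk_between_def walk_length_def conj_assoc)

lemma walk_between_iff:
  "walk_between K x y p \<longleftrightarrow>
     p \<noteq> [] \<and> set p \<subseteq> pverts K \<and> set (vwalk_arcs p) \<subseteq> sym_arcs K \<and> hd p = x \<and> last p = y"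
proof -
  have "parcs (mk_symmetric (with_proj K)) = sym_arcs K"
    by (force simp: parcs_mk_symmetric)
  then show ?thesis
    by (auto simp: walk_between_def vwalk_def)
qed

lemma walk_length_simps [simp]:
  "walk_length l [x] = 0"
  "p \<noteq> [] \<Longrightarrow> walk_length l (x # p) = l x (hd p) + walk_length l p"
  by (simp_all add: walk_length_def)

lemma walk_between_single: "x \<in> pverts K \<Longrightarrow> walk_between K x x [x]"
  by (simp add: walk_between_iff)

lemma walk_between_Cons:
  "walk_between K y z p \<Longrightarrow> x \<in> pverts K \<Longrightarrow> (x, y) \<in> sym_arcs K \<Longrightarrow> walk_between K x z (x # p)"
  by (auto simp: walk_between_iff)

lemma walk_between_ends: "walk_between K x y p \<Longrightarrow> x \<in> pverts K \<and> y \<in> pverts K"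
  by (auto simp: walk_between_iff)

lemma walk_between_induct [consumes 1, case_names single Cons]:
  assumes "walk_between K x y p"
    and "\<And>y. y \<in> pverts K \<Longrightarrow> P y y [y]"
    and "\<And>x w y p. walk_between K w y p \<Longrightarrow> x \<in> pverts K \<Longrightarrow> (x, w) \<in> sym_arcs K \<Longrightarrow> P w y p
           \<Longrightarrow> P x y (x # p)"
  shows "P x y p"
  using assms(1)
proof (induction p arbitrary: x)
  case (Cons a p)
  show ?case
  proof (cases "p = []")
    case True
    with Cons.prems show ?thesis by (auto simp: walk_between_iff intro: assms(2))
  next
    case False
    with Cons.prems have "walk_between K (hd p) y p" "a = x" "x \<in> pverts K" "(x, hd p) \<in> sym_arcs K"
      by (auto simp: walk_between_iff)
    with Cons.IH assms(3) show ?thesis by blast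
  qed
qed (simp add: walk_between_iff)

lemma walk_between_append:
  assumes "walk_between K x y p" "walk_between K y z q"
  shows "\<exists>r. walk_between K x z r \<and> walk_length l r = walk_length l p + walk_length l q"
  using assms
proof (induction rule: walk_between_induct)
  case (Cons x w y p)
  then obtain r where r: "walk_between K w z r" "walk_length l r = walk_length l p + walk_length l q"
    by blast
  with Cons.hyps have "walk_between K x z (x # r)" "p \<noteq> []" "r \<noteq> []" "hd p = w" "hd r = w"
    by (auto intro: walk_between_Cons simp: walk_between_iff)
  with r show ?case by (intro exI[of _ "x # r"]) simp
qed auto

lemma walk_between_rev:
  assumes "walk_between K x y p" and sym: "\<And>u v. l u v = l v u"
  shows "\<exists>r. walk_between K y x r \<and> walk_length l r = walk_length l p"
  using assms(1)
proof (induction rule: walk_between_induct)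
  case (single y)
  then show ?case by (metis walk_between_single)
next
  case (Cons x w y p)
  then obtain r where r: "walk_between K y w r" "walk_length l r = walk_length l p"
    by blast
  have "walk_between K w x [w, x]"
    using Cons.hyps walk_between_ends[OF Cons.hyps(1)] by (auto simp: walk_between_iff)
  from walk_between_append[OF r(1) this, of l] r(2) Cons.hyps(1) show ?case
    using sym[of w x] by (auto simp: walk_between_iff)
qed

lemma rtrancl_walk_between:
  assumes "(x, y) \<in> (sym_arcs K)\<^sup>*" "parcs K \<subseteq> pverts K \<times> pverts K" "y \<in> pverts K"
  shows "\<exists>p. walk_between K x y p"
  using assms(1)
proof (induction rule: converse_rtrancl_induct)
  case base
  then show ?case using assms(3) walk_between_single by metis
next
  case (step x w)
  then show ?case using assms(2) walk_between_Cons by (metis Un_iff converseD mem_Sigma_iff subsetD)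
qed

lemma walk_between_rtrancl:
  "walk_between K x y p \<Longrightarrow> (x, y) \<in> (sym_arcs K)\<^sup>*"
  by (induction rule: walk_between_induct) (auto intro: converse_rtrancl_into_rtrancl)

section \<open>Lengths of walks and the metric they induce\<close>

lemma walk_length_nonneg:
  assumes "walk_between K x y p" "\<And>u v. (u, v) \<in> sym_arcs K \<Longrightarrow> l u v \<ge> 0"
  shows "walk_length l p \<ge> 0"
  using assms(1)
proof (induction rule: walk_between_induct)
  case (Cons x w y p)
  then have "p \<noteq> []" "hd p = w" by (auto simp: walk_between_iff)
  with Cons assms(2)[of x w] show ?case by simp
qed simp

lemma walk_length_pos:
  assumes "walk_between K x y p" "x \<noteq> y" "\<And>u v. (u, v) \<in> sym_arcs K \<Longrightarrow> l u v > 0"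
  shows "walk_length l p > 0"
  using assms(1,2)
proof (induction rule: walk_between_induct)
  case (Cons x w y p)
  then have "p \<noteq> []" "hd p = w" by (auto simp: walk_between_iff)
  moreover have "walk_length l p \<ge> 0"
    using Cons.hyps(1) by (rule walk_length_nonneg) (use assms(3) less_imp_le in blast)
  ultimately show ?case using assms(3)[of x w] Cons.hyps by simp
qed simp

text \<open>\<open>D\<close> will be \<bar>g x - g y\<bar> for a Lipschitz function
  \<open>g\<close>. This is only a pseudometric, hence the weak assumptions on
  \<open>D\<close>.\<close>

lemma walk_length_ge_dist:
  assumes "walk_between K x y p" "\<And>u. D u u = 0"
    and "\<And>u v w. u \<in> pverts K \<Longrightarrow> v \<in> pverts K \<Longrightarrow> w \<in> pverts K \<Longrightarrow> D u w \<le> D u v + D v w"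
    and "\<And>u v. (u, v) \<in> sym_arcs K \<Longrightarrow> D u v \<le> l u v"
  shows "D x y \<le> walk_length l p"
  using assms(1)
proof (induction rule: walk_between_induct)
  case (Cons x w y p)
  then have "p \<noteq> []" "hd p = w" by (auto simp: walk_between_iff)
  moreover have "w \<in> pverts K" "y \<in> pverts K" using walk_between_ends[OF Cons.hyps(1)] by auto
  ultimately show ?case using assms(3)[of x w y] assms(4)[of x w] Cons by fastforce
qed (simp add: assms(2))

text \<open>Arc lengths are bounded below by some \<open>m\<close> > 0, so a walk that is no longer
  than \<open>p0\<close> has a bounded number of vertices. Only finitely many walks compete.\<close>

lemma shortest_walk:
  assumes fin: "finite (pverts K)" "finite (parcs K)"
    and pos: "\<And>u v. (u, v) \<in> sym_arcs K \<Longrightarrow> l u v > 0"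
    and ex: "walk_between K x y p0"
  shows "\<exists>p. walk_between K x y p \<and> (\<forall>q. walk_between K x y q \<longrightarrow> walk_length l p \<le> walk_length l q)"
proof -
  obtain m where m: "m > 0" "\<And>u v. (u, v) \<in> sym_arcs K \<Longrightarrow> m \<le> l u v"
  proof (cases "sym_arcs K = {}")
    case True
    then show ?thesis using that[of 1] by auto
  next
    case False
    let ?L = "case_prod l ` sym_arcs K"
    have "finite ?L" "?L \<noteq> {}" using fin False by auto
    moreover have "\<forall>c\<in>?L. c > 0" using pos by (auto simp del: Un_iff)
    ultimately have "Min ?L > 0" using Min_gr_iff[of ?L 0] by blast
    moreover have "Min ?L \<le> l u v" if "(u, v) \<in> sym_arcs K" for u v
      using \<open>finite ?L\<close> that by (intro Min_le) (auto simp del: Un_iff intro: rev_image_eqI)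
    ultimately show ?thesis by (rule that)
  qed
  have len: "m * real (length p - 1) \<le> walk_length l p" if "walk_between K x y p" for x y p
    using that
  proof (induction rule: walk_between_induct)
    case (Cons x w y p)
    then have "p \<noteq> []" "hd p = w" by (auto simp: walk_between_iff)
    then have "length (x # p) - 1 = Suc (length p - 1)" by (cases p) auto
    then have "m * real (length (x # p) - 1) = m + m * real (length p - 1)"
      by (simp add: algebra_simps)
    with Cons m(2)[of x w] \<open>p \<noteq> []\<close> \<open>hd p = w\<close> show ?case by simp
  qed simp
  define B where "B = walk_length l p0"
  define P where "P = {p. walk_between K x y p \<and> walk_length l p \<le> B}"
  have "P \<subseteq> {p. set p \<subseteq> pverts K \<and> length p \<le> Suc (nat \<lceil>B / m\<rceil>)}"
  proof (rule subsetI, intro CollectI conjI)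
    fix p assume "p \<in> P"
    then have p: "walk_between K x y p" "walk_length l p \<le> B" by (auto simp: P_def)
    then show "set p \<subseteq> pverts K" by (simp add: walk_between_iff)
    have "m * real (length p - 1) \<le> B" using len[OF p(1)] p(2) by simp
    then have "real (length p - 1) \<le> B / m" using m(1) by (simp add: field_simps)
    then show "length p \<le> Suc (nat \<lceil>B / m\<rceil>)" by linarith
  qed
  then have "finite P" using finite_lists_length_le[OF fin(1)] by (rule finite_subset)
  moreover have "p0 \<in> P" using ex by (simp add: P_def B_def)
  ultimately obtain p where p: "p \<in> P" "\<And>q. q \<in> P \<Longrightarrow> walk_length l p \<le> walk_length l q"
    using arg_min_if_finite(1)[of P "walk_length l"] arg_min_least[of P _ "walk_length l"] by blast
  have "walk_length l p \<le> walk_length l q" if "walk_between K x y q" for q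
    using that p \<open>p0 \<in> P\<close> by (cases "walk_length l q \<le> B") (auto simp: P_def)
  with p(1) show ?thesis by (auto simp: P_def)
qed

text \<open>A \<open>d2\<close>-geodesic has the same length when its arcs are measured with
  \<open>d1\<close>, and the triangle inequality for \<open>d1\<close> does the rest. Applied in
  both directions, this gives uniqueness of the geodesic metric with given arc lengths.\<close>

lemma geodesic_metric_le:
  assumes "geodesic_metric K d1" "geodesic_metric K d2" "parcs K \<subseteq> pverts K \<times> pverts K"
    and eq: "\<And>u v. (u, v) \<in> parcs K \<Longrightarrow> d1 u v = d2 u v"
    and "x \<in> pverts K" "y \<in> pverts K"
  shows "d1 x y \<le> d2 x y"
proof -
  interpret d1: Metric_space "pverts K" d1 using assms(1) by (simp add: geodesic_metric_def)
  interpret d2: Metric_space "pverts K" d2 using assms(2) by (simp add: geodesic_metric_def)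
  obtain p where p: "walk_between K x y p" "d2 x y = walk_length d2 p"
    using assms(2,5,6) unfolding geodesic_metric_walk by blast
  have eq': "d1 u v = d2 u v" if "(u, v) \<in> sym_arcs K" for u v
    using that eq[of u v] eq[of v u] d1.commute[of u v] d2.commute[of u v] by auto
  show ?thesis using p(1) unfolding p(2)
  proof (induction rule: walk_between_induct)
    case (Cons x w y p)
    then have "p \<noteq> []" "hd p = w" by (auto simp: walk_between_iff)
    moreover have "w \<in> pverts K" "y \<in> pverts K" using walk_between_ends[OF Cons.hyps(1)] by auto
    ultimately show ?case using d1.triangle[of x w y] Cons eq'[of x w] by fastforce
  qed simp
qed

lemma ex1_geodesic_metric:
  fixes l :: "'a \<Rightarrow> 'a \<Rightarrow> real"
  assumes fin: "finite (pverts K)" "finite (parcs K)" and arcs: "parcs K \<subseteq> pverts K \<times> pverts K"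
    and conn: "\<And>x y. x \<in> pverts K \<Longrightarrow> y \<in> pverts K \<Longrightarrow> (x, y) \<in> (sym_arcs K)\<^sup>*"
    and sym: "\<And>u v. l u v = l v u"
    and pos: "\<And>u v. (u, v) \<in> parcs K \<Longrightarrow> l u v > 0"
    and lip: "\<And>u v. (u, v) \<in> parcs K \<Longrightarrow>
      \<exists>g. \<bar>g u - g v\<bar> = l u v \<and> (\<forall>(x, y)\<in>parcs K. \<bar>g x - g y\<bar> \<le> l x y)"
  shows "\<exists>!d. geodesic_metric K d \<and> (\<forall>(u, v)\<in>parcs K. d u v = l u v) \<and>
    (\<forall>x y. x \<notin> pverts K \<or> y \<notin> pverts K \<longrightarrow> d x y = 0)"
proof (rule ex_ex1I)
  have pos': "l u v > 0" if "(u, v) \<in> sym_arcs K" for u v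
    using that pos[of u v] pos[of v u] sym[of u v] by auto
  have "\<exists>p. x \<in> pverts K \<and> y \<in> pverts K \<longrightarrow> walk_between K x y p \<and>
    (\<forall>q. walk_between K x y q \<longrightarrow> walk_length l p \<le> walk_length l q)" for x y
    using shortest_walk[where l = l and x = x and y = y, OF fin pos'] rtrancl_walk_between[OF conn arcs, of x y] by blast
  then obtain p where p: "\<And>x y. x \<in> pverts K \<Longrightarrow> y \<in> pverts K \<Longrightarrow> walk_between K x y (p x y)"
    and short: "\<And>x y q. walk_between K x y q \<Longrightarrow> walk_length l (p x y) \<le> walk_length l q"
    using walk_between_ends by metis
  define D where "D x y = (if x \<in> pverts K \<and> y \<in> pverts K then walk_length l (p x y) else 0)" for x y
  have D_out: "\<forall>x y. x \<notin> pverts K \<or> y \<notin> pverts K \<longrightarrow> D x y = 0"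
    by (auto simp: D_def)
  have D_le: "D x y \<le> walk_length l q" if "walk_between K x y q" for x y q
    using short[OF that] walk_between_ends[OF that] by (simp add: D_def)
  have nonneg: "D x y \<ge> 0" for x y
    using walk_length_nonneg[OF p, where l = l] pos' by (auto simp: D_def less_imp_le)
  have D_sym: "D x y \<le> D y x" for x y
  proof (cases "x \<in> pverts K \<and> y \<in> pverts K")
    case True
    then obtain r where "walk_between K x y r" "walk_length l r = walk_length l (p y x)"
      using walk_between_rev[where l = l, OF p sym] by blast
    then show ?thesis using D_le[of x y r] True by (simp add: D_def)
  qed (auto simp: D_def)
  have D_edge: "D u v = l u v" if uv_arc: "(u, v) \<in> parcs K" for u v
  proof (rule antisym)
    have uv: "u \<in> pverts K" "v \<in> pverts K" using that arcs by auto
    then have "walk_between K u v [u, v]" using that by (auto simp: walk_between_iff)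
    from D_le[OF this] show "D u v \<le> l u v" by simp
    obtain g where g: "\<bar>g u - g v\<bar> = l u v" "\<forall>(x, y)\<in>parcs K. \<bar>g x - g y\<bar> \<le> l x y"
      using lip[OF uv_arc] by blast
    have "\<bar>g u - g v\<bar> \<le> walk_length l (p u v)"
    proof (rule walk_length_ge_dist[OF p[OF uv]])
      fix x y assume "(x, y) \<in> sym_arcs K"
      then show "\<bar>g x - g y\<bar> \<le> l x y" using g(2) sym[of x y] by auto
    qed auto
    then show "l u v \<le> D u v" using g(1) uv by (simp add: D_def)
  qed
  have D_edge': "D u v = l u v" if "(u, v) \<in> sym_arcs K" for u v
    using that D_edge[of u v] D_edge[of v u] sym[of u v] D_sym[of u v] D_sym[of v u] by auto
  have "Metric_space (pverts K) D"
  proof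
    show "D x y \<ge> 0" "D x y = D y x" for x y
      using nonneg D_sym[of x y] D_sym[of y x] by auto
    show "D x y = 0 \<longleftrightarrow> x = y" if xy: "x \<in> pverts K" "y \<in> pverts K" for x y
    proof
      assume "D x y = 0"
      then have "walk_length l (p x y) = 0" using xy by (simp add: D_def)
      then show "x = y"
        using walk_length_pos[OF p[OF xy], of l] pos' by fastforce
    next
      assume "x = y"
      then show "D x y = 0" using D_le[OF walk_between_single, of x] nonneg[of x y] xy by simp
    qed
    show "D x z \<le> D x y + D y z" if "x \<in> pverts K" "y \<in> pverts K" "z \<in> pverts K" for x y z
      using walk_between_append[OF p p, of x y z l] D_le[of x z] that by (fastforce simp: D_def)
  qed
  \<comment> \<open>As \<open>D\<close> and \<open>l\<close> agree on arcs, a shortest walk for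
    \<open>l\<close> is a geodesic for \<open>D\<close>.\<close>
  moreover have "walk_length D q = walk_length l q" if "walk_between K x y q" for x y q
    using that
  proof (induction rule: walk_between_induct)
    case (Cons x w y p)
    then have "p \<noteq> []" "hd p = w" by (auto simp: walk_between_iff)
    with Cons D_edge' show ?case by simp
  qed simp
  ultimately have "geodesic_metric K D"
    unfolding geodesic_metric_walk using p by (simp add: D_def) metis
  with D_edge show "\<exists>d. geodesic_metric K d \<and> (\<forall>(u, v)\<in>parcs K. d u v = l u v) \<and>
    (\<forall>x y. x \<notin> pverts K \<or> y \<notin> pverts K \<longrightarrow> d x y = 0)"
    using D_out by blast
next
  fix d1 d2
  assume 1: "geodesic_metric K d1 \<and> (\<forall>(u, v)\<in>parcs K. d1 u v = l u v) \<and>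
      (\<forall>x y. x \<notin> pverts K \<or> y \<notin> pverts K \<longrightarrow> d1 x y = 0)"
    and 2: "geodesic_metric K d2 \<and> (\<forall>(u, v)\<in>parcs K. d2 u v = l u v) \<and>
      (\<forall>x y. x \<notin> pverts K \<or> y \<notin> pverts K \<longrightarrow> d2 x y = 0)"
  show "d1 = d2"
  proof (intro ext)
    fix x y
    show "d1 x y = d2 x y"
    proof (cases "x \<in> pverts K \<and> y \<in> pverts K")
      case True
      with 1 2 geodesic_metric_le[OF _ _ arcs, of d1 d2 x y] geodesic_metric_le[OF _ _ arcs, of d2 d1 x y]
      show ?thesis by fastforce
    qed (use 1 2 in auto)
  qed
qed

section \<open>The product of graphs\<close>

text \<open>The invariant of the iteration: what makes the metric of a product with left factor
  \<open>H\<close> well defined, and what the product satisfies again (\<open>product_host\<close>).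
  Connectedness is contained in the existence of geodesics.\<close>

definition metric_host :: "'a pair_pre_digraph \<Rightarrow> ('a \<Rightarrow> 'a \<Rightarrow> real) \<Rightarrow> bool" where
  "metric_host H d \<longleftrightarrow>
     finite (pverts H) \<and> finite (parcs H) \<and> parcs H \<subseteq> pverts H \<times> pverts H \<and>
     (\<forall>e\<in>parcs H. fst e \<noteq> snd e) \<and> geodesic_metric H d"

lemma rtrancl_mapped:
  assumes "(x, y) \<in> R\<^sup>*" "\<And>x y. (x, y) \<in> R \<Longrightarrow> (f x, f y) \<in> S\<^sup>*"
  shows "(f x, f y) \<in> S\<^sup>*"
  using assms(1) by induction (auto intro: rtrancl_trans assms(2))

lemma metric_host_arc_pos:
  assumes "metric_host H d" "e \<in> parcs H"
  shows "d (fst e) (snd e) > 0"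
proof -
  interpret Metric_space "pverts H" d
    using assms(1) by (simp add: metric_host_def geodesic_metric_def)
  have "fst e \<in> pverts H" "snd e \<in> pverts H" "fst e \<noteq> snd e"
    using assms by (auto simp: metric_host_def)
  then show ?thesis by (metis nonneg order.strict_iff_order zero)
qed

lemma metric_host_connected:
  "metric_host H d \<Longrightarrow> x \<in> pverts H \<Longrightarrow> y \<in> pverts H \<Longrightarrow> (x, y) \<in> (sym_arcs H)\<^sup>*"
  unfolding metric_host_def geodesic_metric_walk by (metis walk_between_rtrancl)

locale st_metric_graph =
  fixes G :: "'a pair_pre_digraph" and s t :: 'a and d :: "'a \<Rightarrow> 'a \<Rightarrow> real"
  assumes host_G: "metric_host G d"
    and s_in: "s \<in> pverts G" and t_in: "t \<in> pverts G" and s_neq_t: "s \<noteq> t"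
    and d_st: "d s t = 1"
    and d_arc_neq_1: "\<And>u v. (u, v) \<in> parcs G \<Longrightarrow> d u v \<noteq> 1"
begin

sublocale dG: Metric_space "pverts G" d
  using host_G by (simp add: metric_host_def geodesic_metric_def)

lemma finite_G: "finite (pverts G)" "finite (parcs G)"
  using host_G by (simp_all add: metric_host_def)

lemma arc_in: "f \<in> parcs G \<Longrightarrow> fst f \<in> pverts G" "f \<in> parcs G \<Longrightarrow> snd f \<in> pverts G"
  using host_G by (auto simp: metric_host_def)

lemma arc_neq: "f \<in> parcs G \<Longrightarrow> fst f \<noteq> snd f"
  using host_G by (auto simp: metric_host_def)

text \<open>An arc between the terminals would have length d s t = 1.\<close>

lemma arc_not_terminal: "f \<in> parcs G \<Longrightarrow> \<not> (fst f \<in> {s, t} \<and> snd f \<in> {s, t})"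
  using arc_neq[of f] d_arc_neq_1[of "fst f" "snd f"] d_st dG.commute[of s t] by auto

end

section \<open>A single product: cells, gluing and metric\<close>

locale st_product = st_metric_graph G s t d
  for G :: "'a pair_pre_digraph" and s t d +
  fixes H :: "'a pvertex pair_pre_digraph" and dH :: "'a pvertex \<Rightarrow> 'a pvertex \<Rightarrow> real"
  assumes host_H: "metric_host H dH"
begin

abbreviation "ov \<equiv> oslash_vertex H G s t"
abbreviation "oe \<equiv> oslash_edge H G s t"
abbreviation "K \<equiv> oslash H G s t"

sublocale dH: Metric_space "pverts H" dH
  using host_H by (simp add: metric_host_def geodesic_metric_def)

lemma finite_H: "finite (pverts H)" "finite (parcs H)"
  using host_H by (simp_all add: metric_host_def)

lemma H_arc_in: "e \<in> parcs H \<Longrightarrow> fst e \<in> pverts H" "e \<in> parcs H \<Longrightarrow> snd e \<in> pverts H"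
  using host_H by (auto simp: metric_host_def)

lemma H_arc_neq: "e \<in> parcs H \<Longrightarrow> fst e \<noteq> snd e"
  using host_H by (auto simp: metric_host_def)

lemma ov_in: "e \<in> parcs H \<Longrightarrow> u \<in> pverts G \<Longrightarrow> ov e u \<in> pverts K"
  unfolding oslash_def pair_pre_digraph.simps by blast

lemma ov_eq_iff:
  assumes "e1 \<in> parcs H" "u1 \<in> pverts G" "e2 \<in> parcs H" "u2 \<in> pverts G"
  shows "ov e1 u1 = ov e2 u2 \<longleftrightarrow> e1 = e2 \<and> u1 = u2 \<or>
    u1 \<in> {s, t} \<and> u2 \<in> {s, t} \<and> endpoint s e1 u1 = endpoint s e2 u2"
  using oslash_vertex_eq_iff[of H G e1 u1 e2 u2 s t] assms finite_H finite_G H_arc_neq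
  by (simp add: oslash_rel_def)

lemma ov_eq_same:
  assumes "e \<in> parcs H" "u \<in> pverts G" "v \<in> pverts G"
  shows "ov e u = ov e v \<longleftrightarrow> u = v"
  using assms H_arc_neq[of e] by (auto simp: ov_eq_iff endpoint_def split: if_splits)

lemma ov_eq_different:
  assumes "e1 \<in> parcs H" "u1 \<in> pverts G" "e2 \<in> parcs H" "u2 \<in> pverts G" "ov e1 u1 = ov e2 u2" "e1 \<noteq> e2"
  shows "u1 \<in> {s, t}"
  using assms by (auto simp: ov_eq_iff)

text \<open>Different cells meet only in terminals, so an edge common to two cells would join s and
  t in \<open>G\<close>.\<close>

lemma oe_eq_iff:
  assumes "e1 \<in> parcs H" "f1 \<in> parcs G" "e2 \<in> parcs H" "f2 \<in> parcs G"
  shows "oe e1 f1 = oe e2 f2 \<longleftrightarrow> e1 = e2 \<and> f1 = f2"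
proof
  assume eq: "oe e1 f1 = oe e2 f2"
  have "e1 = e2"
  proof (rule ccontr)
    assume "e1 \<noteq> e2"
    with eq have "fst f1 \<in> {s, t}" "snd f1 \<in> {s, t}"
      using ov_eq_different[of e1 "fst f1" e2 "fst f2"] ov_eq_different[of e1 "snd f1" e2 "snd f2"]
        assms arc_in by (auto simp: oslash_edge_def)
    with assms(2) arc_not_terminal show False by blast
  qed
  with eq show "e1 = e2 \<and> f1 = f2"
    using assms arc_in by (auto simp: oslash_edge_def ov_eq_same prod_eq_iff)
qed auto

lemma oe_inj: "inj_on (case_prod oe) (parcs H \<times> parcs G)"
  by (auto simp: inj_on_def oe_eq_iff)

lemma parcs_product: "parcs K = case_prod oe ` (parcs H \<times> parcs G)"
  by (auto simp: oslash_def)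

lemma parcs_productE:
  assumes "x \<in> parcs K"
  obtains e f where "e \<in> parcs H" "f \<in> parcs G" "x = oe e f"
  using assms unfolding oslash_def pair_pre_digraph.simps by blast

lemma sum_parcs_product:
  "(\<Sum>x\<in>parcs K. g x) = (\<Sum>e\<in>parcs H. \<Sum>f\<in>parcs G. g (oe e f))"
  proof -
  have "(\<Sum>x\<in>parcs K. g x) = (\<Sum>p\<in>parcs H \<times> parcs G. g (case_prod oe p))"
    unfolding parcs_product by (subst sum.reindex[OF oe_inj]) simp
  then show ?thesis by (simp add: sum.cartesian_product case_prod_unfold)
qed

lemma oslash_measure_oe:
  assumes "e \<in> parcs H" "f \<in> parcs G"
  shows "oslash_measure H G s t \<nu>H \<nu>G (oe e f) = \<nu>H e * \<nu>G f"
proof -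
  have "{(e', f'). e' \<in> parcs H \<and> f' \<in> parcs G \<and> oe e' f' = oe e f} = {(e, f)}"
    using assms by (auto simp: oe_eq_iff)
  then show ?thesis by (simp add: oslash_measure_def)
qed

text \<open>Universal property of the gluing: functions on the cells descend to the product once
  their values at the terminals come from one function \<open>h\<close> on the vertices of
  \<open>H\<close>. It serves to construct Lipschitz functions and, with boolean values, sets of
  vertices.\<close>

lemma product_glue:
  assumes "\<And>e. e \<in> parcs H \<Longrightarrow> F e s = h (fst e)" "\<And>e. e \<in> parcs H \<Longrightarrow> F e t = h (snd e)"
  obtains g where "\<And>e u. e \<in> parcs H \<Longrightarrow> u \<in> pverts G \<Longrightarrow> g (ov e u) = F e u"
proof -
  define P where "P x p \<longleftrightarrow> fst p \<in> parcs H \<and> snd p \<in> pverts G \<and> case_prod ov p = x" for x p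
  define g where "g x = case_prod F (SOME p. P x p)" for x
  have "g (ov e u) = F e u" if eu: "e \<in> parcs H" "u \<in> pverts G" for e u
  proof -
    obtain e' u' where p: "(SOME p. P (ov e u) p) = (e', u')" by (cases "SOME p. P (ov e u) p")
    have "P (ov e u) (e, u)" by (simp add: P_def eu)
    then have "P (ov e u) (e', u')" by (metis p someI)
    then have "e' \<in> parcs H" "u' \<in> pverts G" "ov e' u' = ov e u" by (simp_all add: P_def)
    then have "F e' u' = F e u"
      using eu assms[of e] assms[of e'] s_neq_t by (auto simp: ov_eq_iff endpoint_def split: if_splits)
    then show ?thesis by (simp add: g_def p)
  qed
  then show ?thesis by (rule that)
qed

text \<open>The converse of gluing. For the identity as \<open>g\<close> it yields the embedding of
  the vertices of \<open>H\<close> into the product; for membership in a set it yields the trace of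
  this set on \<open>H\<close>.\<close>

lemma product_restrict:
  obtains h where "\<And>e. e \<in> parcs H \<Longrightarrow> g (ov e s) = h (fst e)"
    "\<And>e. e \<in> parcs H \<Longrightarrow> g (ov e t) = h (snd e)"
proof -
  define Q where "Q x p \<longleftrightarrow> fst p \<in> parcs H \<and> snd p \<in> {s, t} \<and> endpoint s (fst p) (snd p) = x" for x p
  define h where "h x = g (case_prod ov (SOME p. Q x p))" for x
  have "h (endpoint s e u) = g (ov e u)" if eu: "e \<in> parcs H" "u \<in> {s, t}" for e u
  proof -
    obtain e' u' where p: "(SOME p. Q (endpoint s e u) p) = (e', u')"
      by (cases "SOME p. Q (endpoint s e u) p")
    have "Q (endpoint s e u) (e, u)" using eu by (simp add: Q_def)
    then have "Q (endpoint s e u) (e', u')" by (metis p someI)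
    then have "e' \<in> parcs H" "u' \<in> {s, t}" "endpoint s e' u' = endpoint s e u" by (simp_all add: Q_def)
    moreover have "u \<in> pverts G" "u' \<in> pverts G" using calculation(2) eu(2) s_in t_in by auto
    ultimately have "ov e' u' = ov e u" using eu by (simp add: ov_eq_iff)
    then show ?thesis by (simp add: h_def p)
  qed
  then show ?thesis
    using that[of h] s_neq_t by (force simp: endpoint_def)
qed

lemma product_connected:
  assumes "x \<in> pverts K" "y \<in> pverts K"
  shows "(x, y) \<in> (sym_arcs K)\<^sup>*"
proof -
  have cell: "(ov e u, ov e v) \<in> (sym_arcs K)\<^sup>*"
    if "e \<in> parcs H" "u \<in> pverts G" "v \<in> pverts G" for e u v
  proof -
    have "(ov e u, ov e v) \<in> (sym_arcs K)\<^sup>*" if "(u, v) \<in> sym_arcs G" for u v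
    proof (rule r_into_rtrancl)
      show "(ov e u, ov e v) \<in> sym_arcs K"
        using that \<open>e \<in> parcs H\<close> by (force simp: parcs_product oslash_edge_def)
    qed
    then show ?thesis
      by (rule rtrancl_mapped[OF metric_host_connected[OF host_G that(2,3)]])
  qed
  \<comment> \<open>\<open>j\<close> embeds the ends of arcs of \<open>H\<close>. An arc of
    \<open>H\<close> lifts to a walk between the terminals of its cell.\<close>
  obtain j where j: "\<And>e. e \<in> parcs H \<Longrightarrow> ov e s = j (fst e)" "\<And>e. e \<in> parcs H \<Longrightarrow> ov e t = j (snd e)"
    using product_restrict[of "\<lambda>x. x"] by metis
  have H_arc: "(j x, j y) \<in> (sym_arcs K)\<^sup>*" if "(x, y) \<in> sym_arcs H" for x y
  proof -
    have "(j (fst e), j (snd e)) \<in> (sym_arcs K)\<^sup>*" "(j (snd e), j (fst e)) \<in> (sym_arcs K)\<^sup>*"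
      if "e \<in> parcs H" for e
      using cell[OF that s_in t_in] cell[OF that t_in s_in] j[OF that] by simp_all
    from this[of "(x, y)"] this[of "(y, x)"] that show ?thesis by auto
  qed
  have H_conn: "(j x, j y) \<in> (sym_arcs K)\<^sup>*" if "x \<in> pverts H" "y \<in> pverts H" for x y
    by (rule rtrancl_mapped[OF metric_host_connected[OF host_H that] H_arc])
  obtain e u where x: "e \<in> parcs H" "u \<in> pverts G" "x = ov e u"
    using assms(1) by (auto simp: oslash_def)
  obtain e' u' where y: "e' \<in> parcs H" "u' \<in> pverts G" "y = ov e' u'"
    using assms(2) by (auto simp: oslash_def)
  have "(x, j (fst e)) \<in> (sym_arcs K)\<^sup>*" using cell[OF x(1,2) s_in] x j by simp
  also have "(j (fst e), j (fst e')) \<in> (sym_arcs K)\<^sup>*" using H_conn H_arc_in x(1) y(1) by blast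
  also have "(j (fst e'), y) \<in> (sym_arcs K)\<^sup>*" using cell[OF y(1) s_in y(2)] y j by simp
  finally show ?thesis .
qed

text \<open>
  This bounds the length of a walk between the ends of an edge from below: the distance from one
  end, within the cell \<open>e0\<close>, extends to the whole product without increasing by more than
  the prescribed length along any edge.
\<close>

lemma product_lipschitz:
  assumes e0: "e0 \<in> parcs H" and a: "a \<in> pverts G"
  obtains g where "\<And>u. u \<in> pverts G \<Longrightarrow> g (ov e0 u) = dH (fst e0) (snd e0) * d a u"
    "\<And>e f. e \<in> parcs H \<Longrightarrow> f \<in> parcs G \<Longrightarrow>
      \<bar>g (ov e (fst f)) - g (ov e (snd f))\<bar> \<le> dH (fst e) (snd e) * d (fst f) (snd f)"
proof -
  have min_diff: "\<bar>min x y - min x' y'\<bar> \<le> k" if "\<bar>x - x'\<bar> \<le> k" "\<bar>y - y'\<bar> \<le> k" for x x' y y' k :: real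
    using that by (auto simp: min_def)
  define D where "D e = dH (fst e) (snd e)" for e
  have D_nonneg: "D e \<ge> 0" for e by (simp add: D_def)
  have dG_diff: "\<bar>c * d x u - c * d x v\<bar> \<le> c * d u v"
    if "x \<in> pverts G" "u \<in> pverts G" "v \<in> pverts G" "c \<ge> 0" for x u v c
  proof -
    have "\<bar>d x u - d x v\<bar> \<le> d u v"
      using dG.triangle[of x u v] dG.triangle[of x v u] dG.commute[of u v] that by auto
    then have "c * \<bar>d x u - d x v\<bar> \<le> c * d u v" using that by (intro mult_left_mono)
    then show ?thesis using that by (simp add: abs_mult right_diff_distrib[symmetric])
  qed
  have dH_diff: "\<bar>dH z x - dH z y\<bar> \<le> dH x y"
    if "z \<in> pverts H" "x \<in> pverts H" "y \<in> pverts H" for x y z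
    using dH.triangle[of z x y] dH.triangle[of z y x] dH.commute[of x y] that by auto
  \<comment> \<open>\<open>h x\<close> is the distance from the point \<open>a\<close> of the cell
    \<open>e0\<close> to the old vertex \<open>x\<close>: one leaves the cell through its source or
    through its sink.\<close>
  define h where "h x = min (D e0 * d a s + dH (fst e0) x) (D e0 * d a t + dH (snd e0) x)" for x
  have h_diff: "\<bar>h x - h y\<bar> \<le> dH x y" if "x \<in> pverts H" "y \<in> pverts H" for x y
    unfolding h_def
    by (rule min_diff) (use dH_diff[of _ x y] that H_arc_in[OF e0] in auto)
  \<comment> \<open>A point of another cell is entered through the cheaper of the two terminals of
    that cell.\<close>
  define F where "F e u = (if e = e0 then D e0 * d a u
    else min (h (fst e) + D e * d s u) (h (snd e) + D e * d t u))" for e u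
  have st: "\<bar>D e0 * d a s - D e0 * d a t\<bar> \<le> D e0"
    using dG_diff[of a s t "D e0"] a s_in t_in D_nonneg d_st by simp
  \<comment> \<open>Inside \<open>e0\<close>, going to one terminal by way of the other costs an
    additional \<open>D e0\<close>, which is never a gain because \<open>d a s\<close> and
    \<open>d a t\<close> differ by at most d s t = 1. So \<open>F\<close> agrees with
    \<open>h\<close> at the ends of \<open>e0\<close>.\<close>
  have h0: "h (fst e0) = D e0 * d a s" "h (snd e0) = D e0 * d a t"
    using st H_arc_in[OF e0] dH.commute[of "snd e0" "fst e0"]
    by (auto simp: h_def D_def[symmetric] min_def)
  have F_s: "F e s = h (fst e)" and F_t: "F e t = h (snd e)" if "e \<in> parcs H" for e
    using h_diff[of "fst e" "snd e"] H_arc_in[OF that] h0 d_st dG.commute[of t s] s_in t_in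
    by (auto simp: F_def D_def[symmetric] min_def)
  have F_diff: "\<bar>F e u - F e v\<bar> \<le> D e * d u v" if "u \<in> pverts G" "v \<in> pverts G" for e u v
    using dG_diff[OF a that D_nonneg, of e0] dG_diff[OF s_in that D_nonneg, of e]
      dG_diff[OF t_in that D_nonneg, of e]
    by (auto simp: F_def intro!: min_diff)
  obtain g where g: "\<And>e u. e \<in> parcs H \<Longrightarrow> u \<in> pverts G \<Longrightarrow> g (ov e u) = F e u"
    using product_glue[of F h] F_s F_t by blast
  show thesis
  proof (rule that[of g])
    show "g (ov e0 u) = dH (fst e0) (snd e0) * d a u" if "u \<in> pverts G" for u
      using g[OF e0 that] by (simp add: F_def D_def)
    show "\<bar>g (ov e (fst f)) - g (ov e (snd f))\<bar> \<le> dH (fst e) (snd e) * d (fst f) (snd f)"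
      if "e \<in> parcs H" "f \<in> parcs G" for e f
      using F_diff[of "fst f" "snd f" e] g that arc_in by (simp add: D_def)
  qed
qed

lemma oslash_metric_correct:
  "geodesic_metric K (oslash_metric H G s t dH d) \<and>
   (\<forall>e\<in>parcs H. \<forall>f\<in>parcs G.
      oslash_metric H G s t dH d (ov e (fst f)) (ov e (snd f)) = dH (fst e) (snd e) * d (fst f) (snd f)) \<and>
   (\<forall>x y. x \<notin> pverts K \<or> y \<notin> pverts K \<longrightarrow> oslash_metric H G s t dH d x y = 0)"
proof -
  let ?c = "\<lambda>e f. dH (fst e) (snd e) * d (fst f) (snd f)"
  \<comment> \<open>Lengths are attached to unordered pairs of ends, which makes \<open>l\<close>
    symmetric. Such a pair determines the cell, and the arc of \<open>G\<close> up to its direction,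
    so the length is unambiguous.\<close>
  let ?P = "\<lambda>x y c. \<exists>e\<in>parcs H. \<exists>f\<in>parcs G. {x, y} = {ov e (fst f), ov e (snd f)} \<and> c = ?c e f"
  define l where "l x y = (THE c. ?P x y c)" for x y
  have c_unique: "?c e f = ?c e' f'"
    if "e \<in> parcs H" "f \<in> parcs G" "e' \<in> parcs H" "f' \<in> parcs G"
      "{ov e (fst f), ov e (snd f)} = {ov e' (fst f'), ov e' (snd f')}" for e f e' f'
  proof -
    have "e = e'"
    proof (rule ccontr)
      assume ne: "e \<noteq> e'"
      have "u \<in> {s, t}" if "u \<in> pverts G" "ov e u \<in> {ov e' (fst f'), ov e' (snd f')}" for u
        using ov_eq_different[OF \<open>e \<in> parcs H\<close> that(1) \<open>e' \<in> parcs H\<close> _ _ ne] that(2)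
          arc_in[OF \<open>f' \<in> parcs G\<close>] by blast
      then show False
        using that(5) arc_in[OF that(2)] arc_not_terminal[OF that(2)] by blast
    qed
    with that have "{fst f, snd f} = {fst f', snd f'}"
      using arc_in[OF that(2)] arc_in[OF that(4)] by (simp add: doubleton_eq_iff ov_eq_same)
    then have "d (fst f) (snd f) = d (fst f') (snd f')"
      using dG.commute by (auto simp: doubleton_eq_iff)
    with \<open>e = e'\<close> show ?thesis by simp
  qed
  have l_oe: "l (ov e (fst f)) (ov e (snd f)) = ?c e f" if "e \<in> parcs H" "f \<in> parcs G" for e f
    unfolding l_def
  proof (rule the_equality)
    show "?P (ov e (fst f)) (ov e (snd f)) (?c e f)" using that by blast
    fix c assume "?P (ov e (fst f)) (ov e (snd f)) c"
    then obtain e' f' where "e' \<in> parcs H" "f' \<in> parcs G" "c = ?c e' f'"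
      "{ov e (fst f), ov e (snd f)} = {ov e' (fst f'), ov e' (snd f')}" by blast
    with c_unique[of e f e' f'] that show "c = ?c e f" by simp
  qed
  have l_sym: "l u v = l v u" for u v
    by (simp add: l_def insert_commute)
  have "\<exists>!D. geodesic_metric K D \<and> (\<forall>(u, v)\<in>parcs K. D u v = l u v) \<and>
    (\<forall>x y. x \<notin> pverts K \<or> y \<notin> pverts K \<longrightarrow> D x y = 0)"
  proof (rule ex1_geodesic_metric)
    have "pverts K = case_prod ov ` (parcs H \<times> pverts G)" by (auto simp: oslash_def)
    then show "finite (pverts K)" using finite_H finite_G by simp
    show "finite (parcs K)" using finite_H finite_G by (simp add: parcs_product)
    show "parcs K \<subseteq> pverts K \<times> pverts K"
      using arc_in by (force simp: oslash_def oslash_edge_def)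
    show "(x, y) \<in> (sym_arcs K)\<^sup>*" if "x \<in> pverts K" "y \<in> pverts K" for x y
      using that by (rule product_connected)
    show "l u v = l v u" for u v by (rule l_sym)
    show "l u v > 0" if "(u, v) \<in> parcs K" for u v
      using that l_oe metric_host_arc_pos[OF host_H] metric_host_arc_pos[OF host_G]
      by (auto simp: parcs_product oslash_edge_def)
    show "\<exists>g. \<bar>g u - g v\<bar> = l u v \<and> (\<forall>(x, y)\<in>parcs K. \<bar>g x - g y\<bar> \<le> l x y)"
      if uv_arc: "(u, v) \<in> parcs K" for u v
    proof -
      obtain e f where ef: "e \<in> parcs H" "f \<in> parcs G" "u = ov e (fst f)" "v = ov e (snd f)"
        using parcs_productE[OF uv_arc] by (metis oslash_edge_def prod.inject)
      obtain g where g: "\<And>u. u \<in> pverts G \<Longrightarrow> g (ov e u) = dH (fst e) (snd e) * d (fst f) u"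
        "\<And>e f. e \<in> parcs H \<Longrightarrow> f \<in> parcs G \<Longrightarrow> \<bar>g (ov e (fst f)) - g (ov e (snd f))\<bar> \<le> ?c e f"
        using product_lipschitz[OF ef(1) arc_in(1)[OF ef(2)]] by blast
      have "\<bar>g u - g v\<bar> = l u v"
        using ef g(1) arc_in[OF ef(2)] l_oe by simp
      moreover have "\<forall>(x, y)\<in>parcs K. \<bar>g x - g y\<bar> \<le> l x y"
        using g(2) l_oe by (auto simp: parcs_product oslash_edge_def)
      ultimately show ?thesis by blast
    qed
  qed
  moreover have "(\<forall>(u, v)\<in>parcs K. D u v = l u v) \<longleftrightarrow>
     (\<forall>e\<in>parcs H. \<forall>f\<in>parcs G. D (ov e (fst f)) (ov e (snd f)) = ?c e f)" for D
    using l_oe by (auto simp: parcs_product oslash_edge_def)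
  ultimately have "\<exists>!D. geodesic_metric K D \<and>
      (\<forall>e\<in>parcs H. \<forall>f\<in>parcs G. D (ov e (fst f)) (ov e (snd f)) = ?c e f) \<and>
      (\<forall>x y. x \<notin> pverts K \<or> y \<notin> pverts K \<longrightarrow> D x y = 0)"
    by (simp only:)
  from theI'[OF this] show ?thesis
    unfolding oslash_metric_def .
qed

lemma oslash_metric_oe:
  "e \<in> parcs H \<Longrightarrow> f \<in> parcs G \<Longrightarrow>
    oslash_metric H G s t dH d (fst (oe e f)) (snd (oe e f)) = dH (fst e) (snd e) * d (fst f) (snd f)"
  using oslash_metric_correct by (simp add: oslash_edge_def)

lemma product_host: "metric_host K (oslash_metric H G s t dH d)"
  unfolding metric_host_def
proof (intro conjI)
  have "pverts K = case_prod ov ` (parcs H \<times> pverts G)" by (auto simp: oslash_def)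
  then show "finite (pverts K)" using finite_H finite_G by simp
  show "finite (parcs K)" using finite_H finite_G by (simp add: parcs_product)
  show "parcs K \<subseteq> pverts K \<times> pverts K"
    using arc_in by (force simp: oslash_def oslash_edge_def)
  show "\<forall>e\<in>parcs K. fst e \<noteq> snd e"
    using arc_in arc_neq by (auto simp: parcs_product oslash_edge_def ov_eq_same)
  show "geodesic_metric K (oslash_metric H G s t dH d)" using oslash_metric_correct by blast
qed

end

lemma metric_host_Base:
  assumes "metric_host G d"
  shows "metric_host \<lparr>pverts = Base ` pverts G, parcs = map_prod Base Base ` parcs G\<rparr>
    (\<lambda>x y. d (unbase x) (unbase y))" (is "metric_host ?B ?d")
proof -
  interpret Metric_space "pverts G" d
    using assms by (simp add: metric_host_def geodesic_metric_def)
  have "Metric_space (pverts ?B) ?d"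
    by unfold_locales (auto simp: commute intro: triangle)
  have walk: "walk_between ?B (Base x) (Base y) (map Base p) \<and> walk_length ?d (map Base p) = walk_length d p"
    if "walk_between G x y p" for x y p
    using that
  proof (induction rule: walk_between_induct)
    case (single y)
    then show ?case by (simp add: walk_between_single)
  next
    case (Cons x w y p)
    then have "p \<noteq> []" "hd p = w" by (auto simp: walk_between_iff)
    with Cons show ?case by (auto intro!: walk_between_Cons simp: hd_map)
  qed
  have "\<exists>p. walk_between ?B x y p \<and> ?d x y = walk_length ?d p"
    if xy_in: "x \<in> pverts ?B" "y \<in> pverts ?B" for x y
  proof -
    obtain x' y' where xy: "x = Base x'" "y = Base y'" "x' \<in> pverts G" "y' \<in> pverts G"
      using xy_in by auto
    then obtain p where "walk_between G x' y' p" "d x' y' = walk_length d p"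
      using assms unfolding geodesic_metric_walk metric_host_def by metis
    with walk[of x' y' p] xy show ?thesis by (intro exI[of _ "map Base p"]) simp
  qed
  with \<open>Metric_space (pverts ?B) ?d\<close> have "geodesic_metric ?B ?d"
    unfolding geodesic_metric_walk by blast
  then show ?thesis using assms by (auto simp: metric_host_def)
qed

section \<open>Cuts of powers\<close>

lemma perimeter_sum:
  assumes "metric_host K d"
  shows "perimeter K \<nu> d A =
    (\<Sum>e\<in>parcs K. \<nu> e / d (fst e) (snd e) * of_bool ((fst e \<in> A) \<noteq> (snd e \<in> A)))"
proof -
  have "edge_boundary K A = {e \<in> parcs K. (fst e \<in> A) \<noteq> (snd e \<in> A)}"
    using assms by (force simp: edge_boundary_def metric_host_def Int_insert_left card_insert_if)
  then show ?thesis
    using assms unfolding perimeter_def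
    by (auto simp: metric_host_def intro!: sum.mono_neutral_cong_left)
qed

lemma sum_vertex_measure:
  assumes "metric_host K d" "A \<subseteq> pverts K"
  shows "sum (vertex_measure K \<nu>) A =
    (\<Sum>e\<in>parcs K. \<nu> e * ((of_bool (fst e \<in> A) + of_bool (snd e \<in> A)) / 2))"
proof -
  have fin: "finite A" "finite (parcs K)"
    using assms finite_subset by (auto simp: metric_host_def)
  have "vertex_measure K \<nu> x = (\<Sum>e\<in>parcs K. \<nu> e * (of_bool (x = fst e) + of_bool (x = snd e)) / 2)" for x
  proof -
    have "(\<Sum>e | e \<in> parcs K \<and> x \<in> {fst e, snd e}. \<nu> e)
        = (\<Sum>e\<in>parcs K. \<nu> e * (of_bool (x = fst e) + of_bool (x = snd e)))"
      using assms fin by (intro sum.mono_neutral_cong_left) (auto simp: metric_host_def)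
    then show ?thesis by (simp add: vertex_measure_def sum_divide_distrib)
  qed
  then have "sum (vertex_measure K \<nu>) A
      = (\<Sum>x\<in>A. \<Sum>e\<in>parcs K. \<nu> e * (of_bool (x = fst e) + of_bool (x = snd e)) / 2)"
    by simp
  also have "\<dots> = (\<Sum>e\<in>parcs K. \<Sum>x\<in>A. \<nu> e * (of_bool (x = fst e) + of_bool (x = snd e)) / 2)"
    by (rule sum.swap)
  also have "\<dots> = (\<Sum>e\<in>parcs K. \<nu> e * ((of_bool (fst e \<in> A) + of_bool (snd e \<in> A)) / 2))"
    using fin(1)
    by (intro sum.cong refl)
      (simp add: sum_divide_distrib[symmetric] sum_distrib_left[symmetric] sum.distrib of_bool_def sum.delta)
  finally show ?thesis .
qed

text \<open>Write z^a = z^(a-1) * z: for a \<le> 1 the first factor decreases in z, so replacing x +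
  y in it by x or by y can only increase it.\<close>

lemma powr_subadditive:
  fixes x y :: real
  assumes "x \<ge> 0" "y \<ge> 0" "0 \<le> a" "a \<le> 1"
  shows "(x + y) powr a \<le> x powr a + y powr a"
proof (cases "x = 0 \<or> y = 0")
  case False
  with assms have pos: "x > 0" "y > 0" by auto
  have "(x + y) powr a = (x + y) powr (a - 1) * (x + y)"
    using pos by (simp add: powr_diff)
  also have "\<dots> = (x + y) powr (a - 1) * x + (x + y) powr (a - 1) * y"
    by (rule distrib_left)
  also have "\<dots> \<le> x powr (a - 1) * x + y powr (a - 1) * y"
    using pos assms by (intro add_mono mult_right_mono powr_mono2') auto
  also have "\<dots> = x powr a + y powr a"
    using pos by (simp add: powr_diff)
  finally show ?thesis .
qed auto

lemma powr_sum_le: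
  fixes x :: "'b \<Rightarrow> real"
  assumes "\<And>i. i \<in> I \<Longrightarrow> x i \<ge> 0" "0 \<le> a" "a \<le> 1"
  shows "(\<Sum>i\<in>I. x i) powr a \<le> (\<Sum>i\<in>I. x i powr a)"
  using assms(1)
proof (induction I rule: infinite_finite_induct)
  case (insert i I)
  then have "(\<Sum>i\<in>insert i I. x i) powr a \<le> x i powr a + (\<Sum>i\<in>I. x i) powr a"
    using powr_subadditive[of "x i" "\<Sum>i\<in>I. x i" a] assms(2,3) by (simp add: sum_nonneg)
  with insert show ?case by simp
qed auto

section \<open>Words of edges and the cuts they describe\<close>

locale weighted_st_graph = st_metric_graph +
  fixes \<nu> :: "'a \<times> 'a \<Rightarrow> real"
  assumes \<nu>_pos: "\<And>f. f \<in> parcs G \<Longrightarrow> \<nu> f > 0" and \<nu>_sum: "sum \<nu> (parcs G) = 1"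
begin

abbreviation q :: "'a \<times> 'a \<Rightarrow> real" where
  "q f \<equiv> \<nu> f / d (fst f) (snd f)"

lemma arc_pos: "f \<in> parcs G \<Longrightarrow> d (fst f) (snd f) > 0"
  using metric_host_arc_pos[OF host_G] .

lemma q_pos: "f \<in> parcs G \<Longrightarrow> q f > 0"
  using arc_pos \<nu>_pos by simp

text \<open>
  Edges of the \<open>n\<close>-th power are words of length \<open>n\<close> over \<open>parcs G\<close>, and a set of vertices of the
  power is represented by the map \<open>\<phi>\<close> telling for each edge which of its ends lie in the set.
  In \<open>cut n a b \<phi>\<close>, the booleans \<open>a\<close> and \<open>b\<close> tell whether the source and the sink lie in it.
  The recursion is the decomposition of the power as \<open>G \<oslash> G\<^sup>n\<close>, whereas powers are defined as
  \<open>G\<^sup>n \<oslash> G\<close>: the former is what the induction for the isoperimetric inequality needs, and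
  \<open>cut_snoc\<close> passes from one to the other.
\<close>

definition words :: "nat \<Rightarrow> ('a \<times> 'a) list set" where
  "words n = {w. set w \<subseteq> parcs G \<and> length w = n}"

primrec cut :: "nat \<Rightarrow> bool \<Rightarrow> bool \<Rightarrow> (('a \<times> 'a) list \<Rightarrow> bool \<times> bool) \<Rightarrow> bool" where
  "cut 0 a b \<phi> \<longleftrightarrow> \<phi> [] = (a, b)"
| "cut (Suc n) a b \<phi> \<longleftrightarrow> (\<exists>S\<subseteq>pverts G. (s \<in> S) = a \<and> (t \<in> S) = b \<and>
     (\<forall>f\<in>parcs G. cut n (fst f \<in> S) (snd f \<in> S) (\<lambda>w. \<phi> (f # w))))"

definition cut_perimeter :: "nat \<Rightarrow> (('a \<times> 'a) list \<Rightarrow> bool \<times> bool) \<Rightarrow> real" where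
  "cut_perimeter n \<phi> = (\<Sum>w\<in>words n. prod_list (map q w) * of_bool (fst (\<phi> w) \<noteq> snd (\<phi> w)))"

definition cut_mass :: "nat \<Rightarrow> (('a \<times> 'a) list \<Rightarrow> bool \<times> bool) \<Rightarrow> real" where
  "cut_mass n \<phi> =
     (\<Sum>w\<in>words n. prod_list (map \<nu> w) * ((of_bool (fst (\<phi> w)) + of_bool (snd (\<phi> w))) / 2))"

lemma words_0 [simp]: "words 0 = {[]}"
  by (auto simp: words_def)

lemma Cons_in_words [simp]: "f # w \<in> words (Suc n) \<longleftrightarrow> f \<in> parcs G \<and> w \<in> words n"
  by (auto simp: words_def)

lemma sum_words_Cons: "(\<Sum>w\<in>words (Suc n). g w) = (\<Sum>f\<in>parcs G. \<Sum>w\<in>words n. g (f # w))"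
proof -
  have "bij_betw (\<lambda>(f, w). f # w) (parcs G \<times> words n) (words (Suc n))"
    by (rule bij_betw_byWitness[of _ "\<lambda>w. (hd w, tl w)"])
      (auto simp: words_def length_Suc_conv)
  from sum.reindex_bij_betw[OF this, of g] show ?thesis
    by (simp add: sum.cartesian_product case_prod_unfold)
qed

lemma sum_words_snoc: "(\<Sum>w\<in>words (Suc n). g w) = (\<Sum>w\<in>words n. \<Sum>f\<in>parcs G. g (w @ [f]))"
proof (induction n arbitrary: g)
  case 0
  show ?case by (simp add: sum_words_Cons)
next
  case (Suc n)
  have "(\<Sum>w\<in>words (Suc (Suc n)). g w) = (\<Sum>e\<in>parcs G. \<Sum>w\<in>words (Suc n). g (e # w))"
    by (rule sum_words_Cons)
  also have "\<dots> = (\<Sum>e\<in>parcs G. \<Sum>w\<in>words n. \<Sum>f\<in>parcs G. g (e # w @ [f]))"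
    by (simp only: Suc.IH)
  also have "\<dots> = (\<Sum>w\<in>words (Suc n). \<Sum>f\<in>parcs G. g (w @ [f]))"
    by (subst sum_words_Cons) simp
  finally show ?case .
qed

lemma cut_perimeter_Suc:
  "cut_perimeter (Suc n) \<phi> = (\<Sum>f\<in>parcs G. q f * cut_perimeter n (\<lambda>w. \<phi> (f # w)))"
  by (simp add: cut_perimeter_def sum_words_Cons sum_distrib_left mult.assoc)

lemma cut_mass_Suc:
  "cut_mass (Suc n) \<phi> = (\<Sum>f\<in>parcs G. \<nu> f * cut_mass n (\<lambda>w. \<phi> (f # w)))"
  by (simp add: cut_mass_def sum_words_Cons sum_distrib_left mult.assoc)

lemma cut_perimeter_nonneg: "cut_perimeter n \<phi> \<ge> 0"
  by (induction n arbitrary: \<phi>)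
    (auto simp: cut_perimeter_Suc cut_perimeter_def[of 0] intro!: sum_nonneg mult_nonneg_nonneg
      less_imp_le[OF q_pos] simp del: times_divide_eq_left)

lemma cut_mass_bounds: "0 \<le> cut_mass n \<phi> \<and> cut_mass n \<phi> \<le> 1"
proof (induction n arbitrary: \<phi>)
  case (Suc n)
  have "(\<Sum>f\<in>parcs G. \<nu> f * cut_mass n (\<lambda>w. \<phi> (f # w))) \<le> (\<Sum>f\<in>parcs G. \<nu> f * 1)"
    by (intro sum_mono mult_left_mono) (use Suc less_imp_le[OF \<nu>_pos] in auto)
  then show ?case
    using Suc less_imp_le[OF \<nu>_pos] by (auto simp: cut_mass_Suc \<nu>_sum intro!: sum_nonneg)
qed (simp add: cut_mass_def)

text \<open>\<open>\<phi>'\<close> is the trace of the cut on the old vertices, and the sets in the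
  hypothesis are its traces on the cells attached at the last letter. The induction removes the
  first letter and leaves these cells untouched.\<close>

lemma cut_snoc:
  assumes "cut n a b \<phi>'"
    and "\<And>w. w \<in> words n \<Longrightarrow> \<exists>S\<subseteq>pverts G. \<phi>' w = (s \<in> S, t \<in> S) \<and>
      (\<forall>f\<in>parcs G. \<phi> (w @ [f]) = (fst f \<in> S, snd f \<in> S))"
  shows "cut (Suc n) a b \<phi>"
  using assms
proof (induction n arbitrary: a b \<phi> \<phi>')
  case 0
  then show ?case by simp blast
next
  case (Suc n)
  from Suc.prems(1) obtain S where S: "S \<subseteq> pverts G" "(s \<in> S) = a" "(t \<in> S) = b"
    "\<And>f. f \<in> parcs G \<Longrightarrow> cut n (fst f \<in> S) (snd f \<in> S) (\<lambda>w. \<phi>' (f # w))"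
    by auto
  have "cut (Suc n) (fst f \<in> S) (snd f \<in> S) (\<lambda>w. \<phi> (f # w))" if f: "f \<in> parcs G" for f
  proof (rule Suc.IH[OF S(4)[OF f]])
    fix w assume "w \<in> words n"
    with f Suc.prems(2)[of "f # w"] show "\<exists>S\<subseteq>pverts G. \<phi>' (f # w) = (s \<in> S, t \<in> S) \<and>
      (\<forall>fa\<in>parcs G. \<phi> (f # w @ [fa]) = (fst fa \<in> S, snd fa \<in> S))" by simp
  qed
  with S(1-3) show ?case by (subst cut.simps(2)) blast
qed

lemma cut_compl:
  assumes "cut n a b \<phi>"
  shows "cut n (\<not> a) (\<not> b) (\<lambda>w. map_prod Not Not (\<phi> w))"
  using assms
proof (induction n arbitrary: a b \<phi>)
  case (Suc n)
  from Suc.prems obtain S where S: "S \<subseteq> pverts G" "(s \<in> S) = a" "(t \<in> S) = b"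
    "\<And>f. f \<in> parcs G \<Longrightarrow> cut n (fst f \<in> S) (snd f \<in> S) (\<lambda>w. \<phi> (f # w))"
    by auto
  have "cut n (fst f \<in> pverts G - S) (snd f \<in> pverts G - S) (\<lambda>w. map_prod Not Not (\<phi> (f # w)))"
    if "f \<in> parcs G" for f
    using Suc.IH[OF S(4)[OF that]] arc_in[OF that] by simp
  moreover have "pverts G - S \<subseteq> pverts G" "(s \<in> pverts G - S) = (\<not> a)" "(t \<in> pverts G - S) = (\<not> b)"
    using S(2,3) s_in t_in by auto
  ultimately show ?case
    unfolding cut.simps by metis
qed simp

lemma cut_perimeter_compl: "cut_perimeter n (\<lambda>w. map_prod Not Not (\<phi> w)) = cut_perimeter n \<phi>"
  by (simp add: cut_perimeter_def)

lemma cut_mass_compl: "cut_mass n (\<lambda>w. map_prod Not Not (\<phi> w)) = 1 - cut_mass n \<phi>"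
proof (induction n arbitrary: \<phi>)
  case (Suc n)
  have "(\<Sum>f\<in>parcs G. \<nu> f * (1 - cut_mass n (\<lambda>w. \<phi> (f # w))))
    = sum \<nu> (parcs G) - (\<Sum>f\<in>parcs G. \<nu> f * cut_mass n (\<lambda>w. \<phi> (f # w)))"
    by (simp add: right_diff_distrib sum_subtractf)
  with Suc show ?case by (simp add: cut_mass_Suc \<nu>_sum)
next
  case 0
  show ?case by (cases "\<phi> []") (simp add: cut_mass_def)
qed

section \<open>Lower bounds for the perimeters of cuts\<close>

definition separating_cuts_ge_1 :: bool where
  "separating_cuts_ge_1 \<longleftrightarrow> (\<forall>S\<subseteq>pverts G. (s \<in> S) \<noteq> (t \<in> S) \<longrightarrow> 1 \<le> perimeter G \<nu> d S)"

text \<open>The trace on the first level separates the terminals, so the arcs it crosses have total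
  weight at least 1. In the cell of each crossed arc the cut separates the terminals again and has
  perimeter at least 1 by induction.\<close>

lemma separating_cut_perimeter:
  assumes "separating_cuts_ge_1" "cut n a b \<phi>" "a \<noteq> b"
  shows "1 \<le> cut_perimeter n \<phi>"
  using assms(2,3)
proof (induction n arbitrary: a b \<phi>)
  case 0
  then show ?case by (simp add: cut_perimeter_def)
next
  case (Suc n)
  from Suc.prems obtain S where S: "S \<subseteq> pverts G" "(s \<in> S) = a" "(t \<in> S) = b"
    "\<And>f. f \<in> parcs G \<Longrightarrow> cut n (fst f \<in> S) (snd f \<in> S) (\<lambda>w. \<phi> (f # w))"
    by auto
  have "1 \<le> perimeter G \<nu> d S"
    using S Suc.prems assms(1) by (auto simp: separating_cuts_ge_1_def)
  also have "\<dots> = (\<Sum>f\<in>parcs G. q f * of_bool ((fst f \<in> S) \<noteq> (snd f \<in> S)))"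
    by (rule perimeter_sum[OF host_G])
  also have "\<dots> \<le> cut_perimeter (Suc n) \<phi>"
    unfolding cut_perimeter_Suc
    by (intro sum_mono mult_left_mono less_imp_le[OF q_pos])
      (use Suc.IH[OF S(4)] cut_perimeter_nonneg in auto)
  finally show ?case .
qed

lemma cut_perimeter_ge_perimeter:
  assumes "separating_cuts_ge_1"
    and "\<And>f. f \<in> parcs G \<Longrightarrow> cut n (fst f \<in> S) (snd f \<in> S) (\<lambda>w. \<phi> (f # w))"
  shows "perimeter G \<nu> d S \<le> cut_perimeter (Suc n) \<phi>"
  unfolding cut_perimeter_Suc perimeter_sum[OF host_G]
  by (intro sum_mono mult_left_mono less_imp_le[OF q_pos])
    (use separating_cut_perimeter[OF assms(1) assms(2)] cut_perimeter_nonneg in auto)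

context
  fixes \<theta> M :: real
  assumes sep: separating_cuts_ge_1
    and \<theta>: "0 \<le> \<theta>" "\<theta> \<le> 1" and M_pos: "M > 0"
    and q_ge: "\<And>f. f \<in> parcs G \<Longrightarrow> \<nu> f powr \<theta> \<le> q f"
    and M: "\<And>S. S \<noteq> {} \<Longrightarrow> S \<subset> pverts G \<Longrightarrow> 1 \<le> M * perimeter G \<nu> d S"
begin

text \<open>A nontrivial trace gives a lower bound for the perimeter that does not depend on
  \<open>n\<close>; it suffices for every mass because masses are at most 1.\<close>

lemma nontrivial_cut_perimeter:
  assumes "S \<noteq> {}" "S \<subset> pverts G" "0 \<le> m" "m \<le> 1"
    and "\<And>f. f \<in> parcs G \<Longrightarrow> cut n (fst f \<in> S) (snd f \<in> S) (\<lambda>w. \<phi> (f # w))"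
  shows "m powr \<theta> \<le> M * cut_perimeter (Suc n) \<phi>"
proof -
  have "m powr \<theta> \<le> 1 powr \<theta>" using assms \<theta> by (intro powr_mono2) auto
  also have "\<dots> \<le> M * perimeter G \<nu> d S" using M assms by simp
  also have "\<dots> \<le> M * cut_perimeter (Suc n) \<phi>"
    using cut_perimeter_ge_perimeter[OF sep assms(5)] M_pos by simp
  finally show ?thesis .
qed

text \<open>The induction concerns the mass itself and not its minimum with the complementary mass,
  because only the former is a sum over the cells. Sets of large mass are no exception: once a trace
  is nonempty, the constant bound covers them.\<close>

lemma inner_cut_isoperimetric:
  assumes "cut n False False \<phi>"
  shows "cut_mass n \<phi> powr \<theta> \<le> M * cut_perimeter n \<phi>"
  using assms
proof (induction n arbitrary: \<phi>)
  \<comment> \<open>Neither end of the single edge lies in the set, so both sides vanish; for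
    \<theta> = 0 this relies on \<open>0 powr 0 = 0\<close>.\<close>
  case 0
  then show ?case by (simp add: cut_mass_def cut_perimeter_def)
next
  case (Suc n)
  from Suc.prems obtain S where S: "S \<subseteq> pverts G" "s \<notin> S"
    "\<And>f. f \<in> parcs G \<Longrightarrow> cut n (fst f \<in> S) (snd f \<in> S) (\<lambda>w. \<phi> (f # w))"
    by auto
  show ?case
  proof (cases "S = {}")
    case False
    then show ?thesis
      using nontrivial_cut_perimeter[of S "cut_mass (Suc n) \<phi>" n \<phi>] S s_in cut_mass_bounds[of "Suc n" \<phi>]
      by blast
  next
    case True
    have "cut_mass (Suc n) \<phi> powr \<theta> \<le> (\<Sum>f\<in>parcs G. (\<nu> f * cut_mass n (\<lambda>w. \<phi> (f # w))) powr \<theta>)"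
      unfolding cut_mass_Suc
      by (intro powr_sum_le \<theta> mult_nonneg_nonneg less_imp_le[OF \<nu>_pos]) (use cut_mass_bounds in auto)
    also have "\<dots> \<le> (\<Sum>f\<in>parcs G. q f * (M * cut_perimeter n (\<lambda>w. \<phi> (f # w))))"
    proof (rule sum_mono)
      fix f assume f: "f \<in> parcs G"
      have "(\<nu> f * cut_mass n (\<lambda>w. \<phi> (f # w))) powr \<theta> = \<nu> f powr \<theta> * cut_mass n (\<lambda>w. \<phi> (f # w)) powr \<theta>"
        by (rule powr_mult)
      also have "\<dots> \<le> q f * (M * cut_perimeter n (\<lambda>w. \<phi> (f # w)))"
        using q_ge[OF f] Suc.IH S(3)[OF f] True q_pos[OF f] by (intro mult_mono) auto
      finally show "(\<nu> f * cut_mass n (\<lambda>w. \<phi> (f # w))) powr \<theta> \<le> q f * (M * cut_perimeter n (\<lambda>w. \<phi> (f # w)))" .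
    qed
    also have "\<dots> = M * cut_perimeter (Suc n) \<phi>"
      by (simp add: cut_perimeter_Suc sum_distrib_left mult_ac)
    finally show ?thesis .
  qed
qed

lemma cut_isoperimetric:
  assumes "cut (Suc n) a b \<phi>"
  shows "min (cut_mass (Suc n) \<phi>) (1 - cut_mass (Suc n) \<phi>) powr \<theta> \<le> M * cut_perimeter (Suc n) \<phi>"
proof -
  let ?m = "cut_mass (Suc n) \<phi>"
  from assms obtain S where S: "S \<subseteq> pverts G" "(s \<in> S) = a" "(t \<in> S) = b"
    "\<And>f. f \<in> parcs G \<Longrightarrow> cut n (fst f \<in> S) (snd f \<in> S) (\<lambda>w. \<phi> (f # w))"
    by auto
  note bounds = cut_mass_bounds[of "Suc n" \<phi>]
  show ?thesis
  proof (cases "S = {} \<or> S = pverts G")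
    case False
    then show ?thesis using S bounds by (intro nontrivial_cut_perimeter[of S]) auto
  next
    case True
    then have "a = b" using S s_in t_in by auto
    show ?thesis
    proof (cases a)
      case True
      then have "cut (Suc n) False False (\<lambda>w. map_prod Not Not (\<phi> w))"
        using cut_compl[OF assms] \<open>a = b\<close> by simp
      from inner_cut_isoperimetric[OF this]
      have "(1 - ?m) powr \<theta> \<le> M * cut_perimeter (Suc n) \<phi>"
        by (simp only: cut_mass_compl cut_perimeter_compl)
      moreover have "min ?m (1 - ?m) powr \<theta> \<le> (1 - ?m) powr \<theta>"
        using \<theta> bounds by (intro powr_mono2) auto
      ultimately show ?thesis by simp
    next
      case False
      then have "?m powr \<theta> \<le> M * cut_perimeter (Suc n) \<phi>"
        using inner_cut_isoperimetric[of "Suc n" \<phi>] assms \<open>a = b\<close> by simp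
      moreover have "min ?m (1 - ?m) powr \<theta> \<le> ?m powr \<theta>"
        using \<theta> bounds by (intro powr_mono2) auto
      ultimately show ?thesis by simp
    qed
  qed
qed

end

end

section \<open>Coarea inequality\<close>

lemma has_integral_of_bool_ge:
  fixes x :: real
  assumes "x \<ge> 0"
  shows "((\<lambda>r. of_bool (x \<le> r)) has_integral (1 - min x 1)) {0..1}"
proof (cases "x \<le> 1")
  case True
  have "((\<lambda>r. 1::real) has_integral (1 - x)) {x..1}"
    using has_integral_const_real[of "1::real" x 1] True by simp
  then have "((\<lambda>r. if r \<in> {x..1} then 1 else 0 :: real) has_integral (1 - x)) {0..1}"
    using assms by (subst has_integral_restrict) auto
  then have "((\<lambda>r. of_bool (x \<le> r)) has_integral (1 - x)) {0..1::real}"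
    by (rule has_integral_eq[rotated]) auto
  with True show ?thesis by simp
next
  case False
  then have "((\<lambda>r. of_bool (x \<le> r)) has_integral (0::real)) {0..1}"
    by (intro has_integral_is_0) auto
  with False show ?thesis by simp
qed

text \<open>The coarea formula for one edge, where \<open>x\<close> and \<open>y\<close> will be the
  distances of its ends from the source. They are truncated at 1 because the radii stop at d s t =
  1.\<close>

lemma has_integral_of_bool_separated:
  fixes x y :: real
  assumes "x \<ge> 0" "y \<ge> 0"
  shows "((\<lambda>r. of_bool ((x \<le> r) \<noteq> (y \<le> r))) has_integral \<bar>min x 1 - min y 1\<bar>) {0..1}"
proof -
  have *: "((\<lambda>r. of_bool ((x \<le> r) \<noteq> (y \<le> r))) has_integral \<bar>min x 1 - min y 1\<bar>) {0..1}"
    if "x \<ge> 0" "x \<le> y" for x y :: real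
  proof -
    have "((\<lambda>r. of_bool (x \<le> r) - of_bool (y \<le> r)) has_integral ((1 - min x 1) - (1 - min y 1))) {0..1::real}"
      using that by (intro has_integral_diff has_integral_of_bool_ge) auto
    then have "((\<lambda>r. of_bool ((x \<le> r) \<noteq> (y \<le> r))) has_integral ((1 - min x 1) - (1 - min y 1))) {0..1::real}"
      by (rule has_integral_eq[rotated]) (use that in auto)
    moreover have "(1 - min x 1) - (1 - min y 1) = \<bar>min x 1 - min y 1\<bar>"
      using that by auto
    ultimately show ?thesis by (simp only:)
  qed
  show ?thesis
  proof (cases "x \<le> y")
    case False
    have "(\<lambda>r. of_bool ((x \<le> r) \<noteq> (y \<le> r)) :: real) = (\<lambda>r. of_bool ((y \<le> r) \<noteq> (x \<le> r)))"
      by (intro ext) (simp add: eq_commute)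
    with *[of y x] assms False show ?thesis by (simp add: abs_minus_commute)
  qed (use * assms in blast)
qed

lemma rtrancl_crossing:
  assumes "(x, y) \<in> R\<^sup>*" "x \<in> S" "y \<notin> S"
  obtains u v where "(u, v) \<in> R" "u \<in> S" "v \<notin> S"
proof -
  have "y \<in> S \<or> (\<exists>u v. (u, v) \<in> R \<and> u \<in> S \<and> v \<notin> S)"
    using assms(1,2) by induction auto
  with assms(3) that show thesis by blast
qed

lemma metric_host_incident_arc:
  assumes "metric_host K d" "x \<in> pverts K" "y \<in> pverts K" "x \<noteq> y"
  obtains e where "e \<in> parcs K" "x = fst e \<or> x = snd e"
proof -
  obtain u v where "(u, v) \<in> sym_arcs K" "u \<in> {x}"
    using rtrancl_crossing[OF metric_host_connected[OF assms(1-3)], of "{x}"] assms(4) by blast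
  then show thesis using that[of "(u, v)"] that[of "(v, u)"] by auto
qed

context weighted_st_graph
begin

lemma perimeter_nonneg: "perimeter G \<nu> d S \<ge> 0"
  unfolding perimeter_sum[OF host_G]
  by (intro sum_nonneg mult_nonneg_nonneg less_imp_le[OF q_pos]) auto

lemma perimeter_pos:
  assumes "S \<noteq> {}" "S \<subset> pverts G"
  shows "perimeter G \<nu> d S > 0"
proof -
  obtain x y where "x \<in> S" "y \<in> pverts G" "y \<notin> S" using assms by blast
  then obtain u v where uv: "(u, v) \<in> sym_arcs G" "u \<in> S" "v \<notin> S"
    using rtrancl_crossing[OF metric_host_connected[OF host_G], of x y S] assms by blast
  then obtain f where f: "f \<in> parcs G" "(fst f \<in> S) \<noteq> (snd f \<in> S)" by force
  then show ?thesis
    unfolding perimeter_sum[OF host_G]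
    by (intro sum_pos2[of _ f] finite_G mult_nonneg_nonneg less_imp_le[OF q_pos]) (use q_pos[OF f(1)] in auto)
qed

lemma perimeter_compl: "perimeter G \<nu> d (pverts G - S) = perimeter G \<nu> d S"
  unfolding perimeter_sum[OF host_G] by (intro sum.cong refl) (auto dest: arc_in)

text \<open>
  Coarea: the average of the perimeters of the balls around the source of radius \<open>r \<in> [0, 1)\<close>
  is at most \<open>\<Sum>f. q f * d f = 1\<close>. As each perimeter is at least \<open>1\<close>, equality holds throughout.
\<close>

lemma separating_cuts_arc_bounds:
  assumes sep: separating_cuts_ge_1 and f0: "f0 \<in> parcs G"
  shows "d (fst f0) (snd f0) < 1" "q f0 \<le> 1"
proof -
  define I where "I f r = (of_bool ((d s (fst f) \<le> r) \<noteq> (d s (snd f) \<le> r)) :: real)" for f r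
  define D where "D f = \<bar>min (d s (fst f)) 1 - min (d s (snd f)) 1\<bar>" for f
  have I: "(I f has_integral D f) {0..1}" for f
    unfolding I_def D_def by (rule has_integral_of_bool_separated) auto
  have D_le: "D f \<le> d (fst f) (snd f)" if "f \<in> parcs G" for f
    using arc_in[OF that] s_in dG.triangle[of s "fst f" "snd f"] dG.triangle[of s "snd f" "fst f"]
      dG.commute[of "snd f" "fst f"] by (auto simp: D_def min_def)
  have qD: "q f * D f \<le> \<nu> f" if "f \<in> parcs G" for f
    using mult_left_mono[OF D_le[OF that] less_imp_le[OF q_pos[OF that]]] arc_pos[OF that] by simp
  have perim: "perimeter G \<nu> d {x \<in> pverts G. d s x \<le> r} = (\<Sum>f\<in>parcs G. q f * I f r)" for r
    unfolding perimeter_sum[OF host_G] I_def by (intro sum.cong refl) (simp add: arc_in)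
  have I_terms: "q f * I f r \<ge> 0" if "f \<in> parcs G" for f r
    using q_pos[OF that] by (auto simp: I_def)
  \<comment> \<open>The excess of \<open>q f0\<close> over 1: a ball that separates the terminals
    and cuts \<open>f0\<close> has perimeter at least max 1 (q f0) = 1 + c.\<close>
  define c where "c = max 0 (q f0 - 1)"
  \<comment> \<open>On [0, 1] the term \<open>I (s, t) r\<close> is 1 except at r = 1, where the
    ball contains the sink as well.\<close>
  have lower: "I (s, t) r + c * I f0 r \<le> (\<Sum>f\<in>parcs G. q f * I f r)" for r
  proof -
    have "I (s, t) r \<le> (\<Sum>f\<in>parcs G. q f * I f r)"
    proof (cases "I (s, t) r = 0")
      case True
      then show ?thesis using I_terms by (simp add: sum_nonneg)
    next
      case False
      then have "I (s, t) r = 1" "(d s s \<le> r) \<noteq> (d s t \<le> r)" by (auto simp: I_def)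
      moreover have "1 \<le> perimeter G \<nu> d {x \<in> pverts G. d s x \<le> r}"
        using sep calculation(2) s_in t_in unfolding separating_cuts_ge_1_def by simp
      ultimately show ?thesis by (simp add: perim)
    qed
    moreover have "q f0 * I f0 r \<le> (\<Sum>f\<in>parcs G. q f * I f r)"
      by (rule member_le_sum[OF f0]) (use I_terms finite_G in auto)
    moreover have "I (s, t) r \<le> 1" "I f0 r = 0 \<or> I f0 r = 1" by (auto simp: I_def)
    ultimately show ?thesis by (auto simp: c_def max_def)
  qed
  have "D (s, t) + c * D f0 \<le> (\<Sum>f\<in>parcs G. q f * D f)"
  proof (rule has_integral_le[OF _ _ lower])
    show "((\<lambda>r. I (s, t) r + c * I f0 r) has_integral D (s, t) + c * D f0) {0..1}"
      by (intro has_integral_add has_integral_mult_right I)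
    show "((\<lambda>r. \<Sum>f\<in>parcs G. q f * I f r) has_integral (\<Sum>f\<in>parcs G. q f * D f)) {0..1}"
      by (intro has_integral_sum finite_G has_integral_mult_right I)
  qed
  moreover have "D (s, t) = 1" using d_st s_in by (simp add: D_def)
  ultimately have main: "1 + c * D f0 \<le> (\<Sum>f\<in>parcs G. q f * D f)" by simp
  \<comment> \<open>Every term is at most its \<nu>, and these sum to 1. As the total is at least 1,
    the term of \<open>f0\<close> attains its bound: the distance from the source, truncated at 1,
    changes along \<open>f0\<close> by the full length of \<open>f0\<close>, which is therefore at
    most 1.\<close>
  have "(\<Sum>f\<in>parcs G. q f * D f) \<le> q f0 * D f0 + (\<Sum>f\<in>parcs G - {f0}. \<nu> f)"
    by (subst sum.remove[OF finite_G(2) f0]) (intro add_mono sum_mono, use qD in auto)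
  also have "\<dots> = q f0 * D f0 + 1 - \<nu> f0"
    using \<nu>_sum sum.remove[OF finite_G(2) f0, of \<nu>] by simp
  finally have upper: "(\<Sum>f\<in>parcs G. q f * D f) \<le> q f0 * D f0 + 1 - \<nu> f0" .
  have "c * D f0 \<ge> 0" by (simp add: c_def D_def)
  with main upper have "\<nu> f0 \<le> q f0 * D f0" by simp
  then have D_ge: "d (fst f0) (snd f0) \<le> D f0"
    using \<nu>_pos[OF f0] arc_pos[OF f0] by (simp add: field_simps)
  moreover have "D f0 \<le> 1"
    using dG.nonneg[of s "fst f0"] dG.nonneg[of s "snd f0"] unfolding D_def abs_le_iff by linarith
  moreover have "d (fst f0) (snd f0) \<noteq> 1" using d_arc_neq_1 f0 by simp
  ultimately show "d (fst f0) (snd f0) < 1" by simp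
  \<comment> \<open>A positive excess \<open>c\<close> would raise the average perimeter above 1,
    because the radii at which \<open>f0\<close> is cut have measure \<open>D f0\<close> >
    0.\<close>
  have "(\<Sum>f\<in>parcs G. q f * D f) \<le> 1"
    using sum_mono[of "parcs G" "\<lambda>f. q f * D f" \<nu>] qD \<nu>_sum by simp
  with main have "c * D f0 \<le> 0" by simp
  moreover have "D f0 > 0" using D_ge arc_pos[OF f0] by simp
  ultimately have "c \<le> 0" by (simp add: mult_le_0_iff)
  then show "q f0 \<le> 1" by (simp add: c_def)
qed

end

section \<open>Isoperimetry of powers\<close>

context weighted_st_graph
begin

abbreviation "GP n \<equiv> oslash_power G s t n"
abbreviation "\<nu>P n \<equiv> measure_power G s t \<nu> n"
abbreviation "dP n \<equiv> metric_power G s t d n"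

lemma power_host: "metric_host (GP n) (dP n)"
proof (induction n)
  case 0
  show ?case using metric_host_Base[OF host_G] by simp
next
  case (Suc n)
  then interpret st_product G s t d "GP n" "dP n" by unfold_locales
  show ?case using product_host by simp
qed

lemma power_product: "st_product G s t d (GP n) (dP n)"
  using power_host by unfold_locales

lemmas sum_parcs_power_Suc =
  st_product.sum_parcs_product[OF power_product, folded oslash_power.simps(2)]

lemma weight_power_Suc:
  assumes "e \<in> parcs (GP n)" "f \<in> parcs G"
  shows "\<nu>P (Suc n) (oslash_edge (GP n) G s t e f) = \<nu>P n e * \<nu> f"
    and "dP (Suc n) (fst (oslash_edge (GP n) G s t e f)) (snd (oslash_edge (GP n) G s t e f)) =
      dP n (fst e) (snd e) * d (fst f) (snd f)"
  using st_product.oslash_measure_oe[OF power_product assms] st_product.oslash_metric_oe[OF power_product assms]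
  by simp_all

text \<open>Edges of \<open>GP n\<close> are named by words of length n + 1, in accordance with the
  shifted exponents. The last letter is the arc of \<open>G\<close> inside the cell named by the
  preceding letters.\<close>

primrec word_edge :: "nat \<Rightarrow> ('a \<times> 'a) list \<Rightarrow> 'a pvertex \<times> 'a pvertex" where
  "word_edge 0 w = map_prod Base Base (hd w)"
| "word_edge (Suc n) w = oslash_edge (GP n) G s t (word_edge n (butlast w)) (last w)"

lemma words_Suc_cases:
  assumes "w \<in> words (Suc n)"
  obtains w' f where "w = w' @ [f]" "w' \<in> words n" "f \<in> parcs G"
  using assms by (cases w rule: rev_cases) (auto simp: words_def)

lemma word_edge_in: "w \<in> words (Suc n) \<Longrightarrow> word_edge n w \<in> parcs (GP n)"
proof (induction n arbitrary: w)
  case 0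
  then obtain f where "w = [f]" "f \<in> parcs G"
    by (auto elim: words_Suc_cases)
  then show ?case by simp
next
  case (Suc n)
  from Suc.prems obtain w' f where w: "w = w' @ [f]" "w' \<in> words (Suc n)" "f \<in> parcs G"
    by (rule words_Suc_cases)
  have "case_prod (oslash_edge (GP n) G s t) (word_edge n w', f) \<in> parcs (GP (Suc n))"
    unfolding oslash_power.simps st_product.parcs_product[OF power_product]
    by (rule imageI) (use w Suc.IH in blast)
  then show ?case by (simp add: w(1))
qed

lemma sum_parcs_power: "(\<Sum>x\<in>parcs (GP n). g x) = (\<Sum>w\<in>words (Suc n). g (word_edge n w))"
proof (induction n arbitrary: g)
  case 0
  have "inj_on (map_prod Base Base) (parcs G)" by (auto simp: inj_on_def)
  from sum.reindex[OF this, of g] show ?case by (simp add: sum_words_Cons)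
next
  case (Suc n)
  have "(\<Sum>x\<in>parcs (GP (Suc n)). g x)
      = (\<Sum>w\<in>words (Suc n). \<Sum>f\<in>parcs G. g (oslash_edge (GP n) G s t (word_edge n w) f))"
    by (simp only: sum_parcs_power_Suc Suc.IH)
  then show ?case by (simp only: sum_words_snoc[of _ "Suc n"] word_edge.simps butlast_snoc last_snoc)
qed

lemma weight_word_edge:
  assumes "w \<in> words (Suc n)"
  shows "\<nu>P n (word_edge n w) = prod_list (map \<nu> w) \<and>
    \<nu>P n (word_edge n w) / dP n (fst (word_edge n w)) (snd (word_edge n w)) = prod_list (map q w)"
  using assms
proof (induction n arbitrary: w)
  case 0
  then obtain f where "w = [f]" "f \<in> parcs G"
    by (auto elim: words_Suc_cases)
  then show ?case by (cases f) simp
next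
  case (Suc n)
  from Suc.prems obtain w' f where w: "w = w' @ [f]" "w' \<in> words (Suc n)" "f \<in> parcs G"
    by (rule words_Suc_cases)
  let ?e = "word_edge n w'"
  have "word_edge (Suc n) w = oslash_edge (GP n) G s t ?e f" by (simp add: w)
  moreover have "\<nu>P n ?e = prod_list (map \<nu> w')"
    "\<nu>P n ?e / dP n (fst ?e) (snd ?e) = prod_list (map q w')"
    using Suc.IH[OF w(2)] by blast+
  moreover note weight_power_Suc[OF word_edge_in[OF w(2)] w(3)]
  ultimately show ?case
    by (simp only: w(1) map_append prod_list.append list.map prod_list.Cons prod_list.Nil
      mult_1_right times_divide_times_eq[symmetric] simp_thms)
qed

lemmas measure_word_edge = weight_word_edge[THEN conjunct1]
  and ratio_word_edge = weight_word_edge[THEN conjunct2]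

definition power_cut :: "nat \<Rightarrow> 'a pvertex set \<Rightarrow> ('a \<times> 'a) list \<Rightarrow> bool \<times> bool" where
  "power_cut n A w = (fst (word_edge n w) \<in> A, snd (word_edge n w) \<in> A)"

lemma perimeter_power: "perimeter (GP n) (\<nu>P n) (dP n) A = cut_perimeter (Suc n) (power_cut n A)"
  unfolding perimeter_sum[OF power_host] sum_parcs_power cut_perimeter_def
  by (intro sum.cong refl) (simp only: ratio_word_edge power_cut_def fst_conv snd_conv)

lemma mass_power:
  assumes "A \<subseteq> pverts (GP n)"
  shows "sum (vertex_measure (GP n) (\<nu>P n)) A = cut_mass (Suc n) (power_cut n A)"
  unfolding sum_vertex_measure[OF power_host assms] sum_parcs_power cut_mass_def
  by (intro sum.cong refl) (simp only: measure_word_edge power_cut_def fst_conv snd_conv)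

lemma mass_power_compl:
  assumes "A \<subseteq> pverts (GP n)"
  shows "sum (vertex_measure (GP n) (\<nu>P n)) (pverts (GP n) - A) = 1 - cut_mass (Suc n) (power_cut n A)"
proof -
  have "power_cut n (pverts (GP n) - A) w = map_prod Not Not (power_cut n A w)" if "w \<in> words (Suc n)" for w
  proof -
    have "fst (word_edge n w) \<in> pverts (GP n)" "snd (word_edge n w) \<in> pverts (GP n)"
      using word_edge_in[OF that] power_host[of n] by (auto simp: metric_host_def)
    then show ?thesis by (simp add: power_cut_def)
  qed
  then have "cut_mass (Suc n) (power_cut n (pverts (GP n) - A))
      = cut_mass (Suc n) (\<lambda>w. map_prod Not Not (power_cut n A w))"
    unfolding cut_mass_def by (intro sum.cong refl) simp
  then show ?thesis using mass_power[of "pverts (GP n) - A" n] by (simp add: cut_mass_compl)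
qed

text \<open>The trace of \<open>A\<close> on the previous power is again an arbitrary set of
  vertices, to which the induction hypothesis applies; \<open>cut_snoc\<close> then adds the traces
  on the last cells.\<close>

lemma cut_power_cut: "\<exists>a b. cut (Suc n) a b (power_cut n A)"
proof (induction n arbitrary: A)
  case 0
  let ?S = "{u \<in> pverts G. Base u \<in> A}"
  have "cut (Suc 0) (s \<in> ?S) (t \<in> ?S) (power_cut 0 A)"
    by (simp only: cut.simps, intro exI[of _ ?S]) (auto simp: power_cut_def dest: arc_in)
  then show ?case by blast
next
  case (Suc n)
  interpret st_product G s t d "GP n" "dP n" by (rule power_product)
  obtain h where h: "\<And>e. e \<in> parcs (GP n) \<Longrightarrow> (ov e s \<in> A) = h (fst e)"
    "\<And>e. e \<in> parcs (GP n) \<Longrightarrow> (ov e t \<in> A) = h (snd e)"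
    using product_restrict[of "\<lambda>x. x \<in> A"] by metis
  from Suc.IH obtain a b where ab: "cut (Suc n) a b (power_cut n {x. h x})" by blast
  have "cut (Suc (Suc n)) a b (power_cut (Suc n) A)"
  proof (rule cut_snoc[OF ab])
    fix w assume w: "w \<in> words (Suc n)"
    let ?e = "word_edge n w"
    let ?S = "{u \<in> pverts G. ov ?e u \<in> A}"
    have "power_cut n {x. h x} w = (s \<in> ?S, t \<in> ?S)"
      using h[OF word_edge_in[OF w]] s_in t_in by (simp add: power_cut_def)
    moreover have "\<forall>f\<in>parcs G. power_cut (Suc n) A (w @ [f]) = (fst f \<in> ?S, snd f \<in> ?S)"
      using arc_in by (simp add: power_cut_def oslash_edge_def)
    ultimately show "\<exists>S\<subseteq>pverts G. power_cut n {x. h x} w = (s \<in> S, t \<in> S) \<and>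
      (\<forall>f\<in>parcs G. power_cut (Suc n) A (w @ [f]) = (fst f \<in> S, snd f \<in> S))"
      by (intro exI[of _ ?S]) blast
  qed
  then show ?case by blast
qed

section \<open>The exponent, the constant and the inequality for all powers\<close>

definition max_exponent :: real where
  "max_exponent = Max ((\<lambda>(u, v). ln (\<nu> (u, v)) / ln (d u v)) ` parcs G)"

definition max_inverse_perimeter :: real where
  "max_inverse_perimeter = Max {inverse (perimeter G \<nu> d S) | S. S \<noteq> {} \<and> S \<subset> pverts G}"

lemma max_inverse_perimeter:
  assumes "S \<noteq> {}" "S \<subset> pverts G"
  shows "1 \<le> max_inverse_perimeter * perimeter G \<nu> d S" "max_inverse_perimeter > 0"
proof -
  let ?I = "{inverse (perimeter G \<nu> d S) | S. S \<noteq> {} \<and> S \<subset> pverts G}"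
  have "?I \<subseteq> (\<lambda>S. inverse (perimeter G \<nu> d S)) ` Pow (pverts G)" by auto
  then have "finite ?I" by (rule finite_subset) (simp add: finite_G)
  then have ge: "inverse (perimeter G \<nu> d S) \<le> max_inverse_perimeter"
    unfolding max_inverse_perimeter_def using assms by (intro Max_ge) auto
  with perimeter_pos[OF assms] show "1 \<le> max_inverse_perimeter * perimeter G \<nu> d S" 
    by (simp add: field_simps)
  have "inverse (perimeter G \<nu> d S) > 0" using perimeter_pos[OF assms] by simp
  from less_le_trans[OF this ge] show "max_inverse_perimeter > 0" .
qed

text \<open>Origin of the exponent: as ln d < 0, the maximum says that d^\<delta> \<le> \<nu> on
  every arc, which is \<nu>^((\<delta>-1)/\<delta>) \<le> \<nu>/d in another form. The bound
  \<delta> \<ge> 1 comes from \<nu>/d \<le> 1. Both signs are supplied by the coarea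
  argument.\<close>

lemma max_exponent_bounds:
  assumes sep: separating_cuts_ge_1
  shows "1 \<le> max_exponent"
    and "f \<in> parcs G \<Longrightarrow> \<nu> f powr ((max_exponent - 1) / max_exponent) \<le> q f"
proof -
  have ln_d: "ln (d (fst f) (snd f)) < 0" if "f \<in> parcs G" for f
    using separating_cuts_arc_bounds(1)[OF sep that] arc_pos[OF that] by simp
  have le: "ln (\<nu> f) / ln (d (fst f) (snd f)) \<le> max_exponent" if "f \<in> parcs G" for f
    unfolding max_exponent_def
    by (rule Max_ge) (use finite_G that in \<open>auto intro!: image_eqI[of _ _ f] simp: case_prod_unfold\<close>)
  obtain e where e: "e \<in> parcs G"
    using metric_host_incident_arc[OF host_G s_in t_in s_neq_t] by blast
  have "\<nu> e \<le> d (fst e) (snd e)"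
    using separating_cuts_arc_bounds(2)[OF sep e] arc_pos[OF e] by simp
  then have "ln (\<nu> e) \<le> ln (d (fst e) (snd e))"
    using \<nu>_pos[OF e] by simp
  then have "1 \<le> ln (\<nu> e) / ln (d (fst e) (snd e))"
    using ln_d[OF e] by (simp add: le_divide_eq)
  with le[OF e] show ge1: "1 \<le> max_exponent" by simp
  show "\<nu> f powr ((max_exponent - 1) / max_exponent) \<le> q f" if f: "f \<in> parcs G"
  proof -
    let ?d = "d (fst f) (snd f)"
    have "max_exponent * ln ?d \<le> ln (\<nu> f)"
      using le[OF f] ln_d[OF f] by (simp add: divide_le_eq)
    then have "ln ?d \<le> 1 / max_exponent * ln (\<nu> f)"
      using ge1 by (simp add: field_simps)
    then have "?d \<le> \<nu> f powr (1 / max_exponent)"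
      using arc_pos[OF f] \<nu>_pos[OF f] by (simp add: powr_def ln_ge_iff[symmetric] flip: ln_le_cancel_iff)
    then have "\<nu> f / \<nu> f powr (1 / max_exponent) \<le> \<nu> f / ?d"
      using arc_pos[OF f] \<nu>_pos[OF f] by (intro divide_left_mono mult_pos_pos) auto
    moreover have "(max_exponent - 1) / max_exponent = 1 - 1 / max_exponent"
      using ge1 by (simp add: diff_divide_distrib)
    ultimately show ?thesis using \<nu>_pos[OF f] by (simp add: powr_diff)
  qed
qed

lemma separating_cuts_imp_isoperimetric:
  assumes sep: separating_cuts_ge_1
  shows "power_has_isoperimetric_dimension G s t \<nu> d n max_exponent max_inverse_perimeter"
proof -
  note exponent = max_exponent_bounds[OF sep]
  have "{s} \<subset> pverts G" using s_in t_in s_neq_t by auto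
  then have M: "max_inverse_perimeter > 0" using max_inverse_perimeter(2)[of "{s}"] by blast
  have "min (sum (vertex_measure (GP n) (\<nu>P n)) A) (sum (vertex_measure (GP n) (\<nu>P n)) (pverts (GP n) - A))
      powr ((max_exponent - 1) / max_exponent) \<le> max_inverse_perimeter * perimeter (GP n) (\<nu>P n) (dP n) A"
    if A: "A \<subseteq> pverts (GP n)" for A
  proof -
    obtain a b where ab: "cut (Suc n) a b (power_cut n A)" using cut_power_cut by blast
    show ?thesis
      unfolding mass_power[OF A] mass_power_compl[OF A] perimeter_power
      by (rule cut_isoperimetric[OF sep _ _ M exponent(2) max_inverse_perimeter(1) ab])
        (use exponent(1) in \<open>auto simp: field_simps\<close>)
  qed
  then show ?thesis
    using exponent(1) M by (simp add: power_has_isoperimetric_dimension_def has_isoperimetric_dimension_def)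
qed

section \<open>From a uniform inequality to separating cuts\<close>

text \<open>
  Unlike the mass of \<open>A\<close>, the inner mass cannot decrease when \<open>A\<close> is refined to a set of vertices
  of the next power.
\<close>

definition inner_mass :: "nat \<Rightarrow> 'a pvertex set \<Rightarrow> real" where
  "inner_mass n A = (\<Sum>e\<in>parcs (GP n). \<nu>P n e * of_bool (fst e \<in> A \<and> snd e \<in> A))"

lemma measure_power_pos: "e \<in> parcs (GP n) \<Longrightarrow> \<nu>P n e > 0"
proof (induction n arbitrary: e)
  case 0
  then show ?case using \<nu>_pos by auto
next
  case (Suc n)
  from Suc.prems obtain e' f where e: "e' \<in> parcs (GP n)" "f \<in> parcs G" "e = oslash_edge (GP n) G s t e' f"
    unfolding oslash_power.simps by (rule st_product.parcs_productE[OF power_product])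
  have "\<nu>P n e' * \<nu> f > 0" using Suc.IH[OF e(1)] \<nu>_pos[OF e(2)] by simp
  then show ?case by (simp only: e(3) weight_power_Suc(1)[OF e(1,2)])
qed

lemma inner_mass_le:
  assumes "A \<subseteq> pverts (GP n)"
  shows "inner_mass n A \<le> sum (vertex_measure (GP n) (\<nu>P n)) A"
  unfolding inner_mass_def sum_vertex_measure[OF power_host assms]
  by (intro sum_mono mult_left_mono less_imp_le[OF measure_power_pos]) auto

lemma inner_mass_compl:
  "inner_mass n (pverts (GP n) - A) = inner_mass n (- A)"
  unfolding inner_mass_def
  by (intro sum.cong refl) (use power_host[of n] in \<open>auto simp: metric_host_def\<close>)

text \<open>A cell whose edge is cut by \<open>A\<close> receives a copy of \<open>S\<close> or of
  its complement, whichever agrees with \<open>A\<close> at the ends; the two have the same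
  boundary, so each cut edge contributes \<open>perimeter G \<nu> d S\<close> times its former
  weight. The other cells are filled or left empty as a whole, which preserves the inner mass on
  either side.\<close>

lemma refine_set:
  assumes S: "s \<in> S" "t \<notin> S"
  obtains A' where "A' \<subseteq> pverts (GP (Suc n))"
    "perimeter (GP (Suc n)) (\<nu>P (Suc n)) (dP (Suc n)) A' = perimeter G \<nu> d S * perimeter (GP n) (\<nu>P n) (dP n) A"
    "inner_mass n A \<le> inner_mass (Suc n) A'" "inner_mass n (- A) \<le> inner_mass (Suc n) (- A')"
proof -
  interpret st_product G s t d "GP n" "dP n" by (rule power_product)
  define F where "F e u = (if (fst e \<in> A) = (snd e \<in> A) then fst e \<in> A
    else if fst e \<in> A then u \<in> S else u \<notin> S)" for e u
  obtain g where g: "\<And>e u. e \<in> parcs (GP n) \<Longrightarrow> u \<in> pverts G \<Longrightarrow> g (ov e u) = F e u"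
  proof (rule product_glue[of F "\<lambda>x. x \<in> A"])
    show "F e s = (fst e \<in> A)" "F e t = (snd e \<in> A)" for e using S by (auto simp: F_def)
  qed blast
  define A' where "A' = {x \<in> pverts (GP (Suc n)). g x}"
  have A'_ov: "ov e u \<in> A' \<longleftrightarrow> F e u" if "e \<in> parcs (GP n)" "u \<in> pverts G" for e u
    using g[OF that] ov_in[OF that] by (simp add: A'_def)
  have oe_in: "fst (oe e f) \<in> A' \<longleftrightarrow> F e (fst f)" "snd (oe e f) \<in> A' \<longleftrightarrow> F e (snd f)"
    if "e \<in> parcs (GP n)" "f \<in> parcs G" for e f
    using A'_ov that arc_in by (simp_all add: oslash_edge_def)
  have inner: "inner_mass n B \<le> inner_mass (Suc n) B'"
    if B: "\<And>e f. e \<in> parcs (GP n) \<Longrightarrow> f \<in> parcs G \<Longrightarrow> fst e \<in> B \<Longrightarrow> snd e \<in> B \<Longrightarrow>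
      fst (oe e f) \<in> B' \<and> snd (oe e f) \<in> B'" for B B'
  proof -
    have "inner_mass n B = (\<Sum>e\<in>parcs (GP n). \<Sum>f\<in>parcs G. \<nu>P n e * \<nu> f * of_bool (fst e \<in> B \<and> snd e \<in> B))"
      by (simp add: inner_mass_def sum_distrib_left[symmetric] sum_distrib_right[symmetric] \<nu>_sum)
    also have "\<dots> \<le> (\<Sum>e\<in>parcs (GP n). \<Sum>f\<in>parcs G.
        \<nu>P (Suc n) (oe e f) * of_bool (fst (oe e f) \<in> B' \<and> snd (oe e f) \<in> B'))"
    proof (intro sum_mono)
      fix e f assume ef: "e \<in> parcs (GP n)" "f \<in> parcs G"
      then have "\<nu>P n e * \<nu> f \<ge> 0" by (intro mult_nonneg_nonneg less_imp_le[OF measure_power_pos] less_imp_le[OF \<nu>_pos])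
      then show "\<nu>P n e * \<nu> f * of_bool (fst e \<in> B \<and> snd e \<in> B)
          \<le> \<nu>P (Suc n) (oe e f) * of_bool (fst (oe e f) \<in> B' \<and> snd (oe e f) \<in> B')"
        using B[OF ef] weight_power_Suc(1)[OF ef] by simp
    qed
    also have "\<dots> = inner_mass (Suc n) B'"
      by (simp only: inner_mass_def sum_parcs_power_Suc)
    finally show ?thesis .
  qed
  have cell: "(\<Sum>f\<in>parcs G. q f * of_bool (F e (fst f) \<noteq> F e (snd f)))
      = perimeter G \<nu> d S * of_bool ((fst e \<in> A) \<noteq> (snd e \<in> A))" for e
  proof -
    have "(F e u \<noteq> F e v) = (((u \<in> S) \<noteq> (v \<in> S)) \<and> ((fst e \<in> A) \<noteq> (snd e \<in> A)))" for u v
      by (auto simp: F_def)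
    then show ?thesis
      by (simp only: perimeter_sum[OF host_G] of_bool_conj sum_distrib_right mult.assoc)
  qed
  have "perimeter (GP (Suc n)) (\<nu>P (Suc n)) (dP (Suc n)) A'
      = (\<Sum>e\<in>parcs (GP n). \<Sum>f\<in>parcs G. \<nu>P n e / dP n (fst e) (snd e) *
          (q f * of_bool (F e (fst f) \<noteq> F e (snd f))))"
    unfolding perimeter_sum[OF power_host] sum_parcs_power_Suc
    by (intro sum.cong refl)
      (simp only: weight_power_Suc oe_in times_divide_times_eq[symmetric] mult.assoc)
  also have "\<dots> = perimeter G \<nu> d S * perimeter (GP n) (\<nu>P n) (dP n) A"
    unfolding sum_distrib_left[symmetric] cell perimeter_sum[OF power_host, of n]
    by (simp only: sum_distrib_left mult_ac)
  finally show thesis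
  proof (rule that[rotated])
    show "A' \<subseteq> pverts (GP (Suc n))" by (auto simp: A'_def)
    show "inner_mass n A \<le> inner_mass (Suc n) A'"
      by (rule inner) (simp add: oe_in F_def)
    show "inner_mass n (- A) \<le> inner_mass (Suc n) (- A')"
      by (rule inner) (simp add: oe_in F_def)
  qed
qed

lemma inner_mass_pos:
  assumes "e \<in> parcs (GP n)" "fst e \<in> A" "snd e \<in> A"
  shows "inner_mass n A > 0"
  unfolding inner_mass_def
  by (rule sum_pos2[OF _ assms(1)])
    (use assms measure_power_pos[OF assms(1)] power_host[of n] in
      \<open>auto simp: metric_host_def intro: less_imp_le[OF measure_power_pos]\<close>)

text \<open>A cell, that is a copy of \<open>G\<close> in its second power, has inner edges, and so has its complement.\<close>

lemma set_with_inner_and_outer_mass: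
  assumes "card (pverts G) > 2"
  obtains A where "A \<subseteq> pverts (GP 1)" "inner_mass 1 A > 0" "inner_mass 1 (- A) > 0"
proof -
  interpret st_product G s t d "GP 0" "dP 0" by (rule power_product)
  have GP_1: "GP 1 = K" by (simp add: One_nat_def del: oslash_power.simps(1))
  obtain fs where fs: "fs \<in> parcs G" "fst fs = s \<or> snd fs = s"
    using metric_host_incident_arc[OF host_G s_in t_in s_neq_t] by metis
  obtain ft where ft: "ft \<in> parcs G" "fst ft = t \<or> snd ft = t"
    using metric_host_incident_arc[OF host_G t_in s_in s_neq_t[symmetric]] by metis
  define e0 where "e0 = map_prod Base Base fs"
  have e0: "e0 \<in> parcs (GP 0)" using fs by (simp add: e0_def)
  have "card (pverts (GP 0)) > 2"
    using assms by (simp add: card_image inj_on_def)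
  moreover have "card {fst e0, snd e0} \<le> 2" by (simp add: card_insert_if)
  \<comment> \<open>Here |V(G)| > 2 enters: a vertex \<open>x\<close> off \<open>e0\<close> leads to
    a second cell \<open>e1\<close> with a terminal outside the set to be built.\<close>
  ultimately have "\<not> pverts (GP 0) \<subseteq> {fst e0, snd e0}"
    using card_mono[of "{fst e0, snd e0}" "pverts (GP 0)"] by auto
  then obtain x where x: "x \<in> pverts (GP 0)" "x \<noteq> fst e0" "x \<noteq> snd e0" by blast
  obtain e1 where e1: "e1 \<in> parcs (GP 0)" "x = fst e1 \<or> x = snd e1"
    using metric_host_incident_arc[OF power_host x(1) H_arc_in(1)[OF e0] x(2)] by blast
  then have "e1 \<noteq> e0" using x by auto
  \<comment> \<open>The whole cell \<open>e0\<close>, together with what gluing forces: its two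
    terminals, seen from the neighbouring cells.\<close>
  define F where "F e u \<longleftrightarrow> e = e0 \<or> u = s \<and> fst e \<in> {fst e0, snd e0} \<or> u = t \<and> snd e \<in> {fst e0, snd e0}" for e u
  obtain g where g: "\<And>e u. e \<in> parcs (GP 0) \<Longrightarrow> u \<in> pverts G \<Longrightarrow> g (ov e u) = F e u"
  proof (rule product_glue[of F "\<lambda>x. x \<in> {fst e0, snd e0}"])
    show "F e s = (fst e \<in> {fst e0, snd e0})" "F e t = (snd e \<in> {fst e0, snd e0})" for e
      using s_neq_t by (auto simp: F_def)
  qed blast
  define A where "A = {x \<in> pverts (GP 1). g x}"
  have A_ov: "ov e u \<in> A \<longleftrightarrow> F e u" if "e \<in> parcs (GP 0)" "u \<in> pverts G" for e u
    using g[OF that] ov_in[OF that] by (simp add: A_def GP_1 del: oslash_power.simps(1))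
  have oe_in: "fst (oe e f) \<in> A \<longleftrightarrow> F e (fst f)" "snd (oe e f) \<in> A \<longleftrightarrow> F e (snd f)"
    if "e \<in> parcs (GP 0)" "f \<in> parcs G" for e f
    using A_ov that arc_in by (simp_all add: oslash_edge_def)
  have oe_arc: "oe e f \<in> parcs (GP 1)" if "e \<in> parcs (GP 0)" "f \<in> parcs G" for e f
    unfolding GP_1 parcs_product using that by (intro image_eqI[of _ _ "(e, f)"]) auto
  \<comment> \<open>Take an arc at the terminal of the cell \<open>e1\<close> that corresponds to
    \<open>x\<close>. Its other end is not a terminal, so both ends avoid the set.\<close>
  obtain f1 where f1: "f1 \<in> parcs G" "\<not> F e1 (fst f1)" "\<not> F e1 (snd f1)"
  proof (cases "x = fst e1")
    case True
    then show thesis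
      using that[of fs] fs x \<open>e1 \<noteq> e0\<close> arc_not_terminal[of fs] s_neq_t by (auto simp: F_def)
  next
    case False
    then show thesis
      using that[of ft] ft x e1 \<open>e1 \<noteq> e0\<close> arc_not_terminal[of ft] s_neq_t by (auto simp: F_def)
  qed
  show thesis
  proof (rule that)
    show "A \<subseteq> pverts (GP 1)" by (auto simp: A_def)
    show "inner_mass 1 A > 0"
      by (rule inner_mass_pos[OF oe_arc[OF e0 fs(1)]]) (use oe_in[OF e0 fs(1)] in \<open>simp_all add: F_def\<close>)
    show "inner_mass 1 (- A) > 0"
      by (rule inner_mass_pos[OF oe_arc[OF e1(1) f1(1)]]) (use oe_in[OF e1(1) f1(1)] f1 in simp_all)
  qed
qed

lemma isoperimetric_imp_separating_cuts:
  assumes card: "card (pverts G) > 2"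
    and iso: "\<And>n. power_has_isoperimetric_dimension G s t \<nu> d n \<delta> C"
  shows separating_cuts_ge_1
proof (rule ccontr)
  assume "\<not> separating_cuts_ge_1"
  then obtain S0 where S0: "S0 \<subseteq> pverts G" "(s \<in> S0) \<noteq> (t \<in> S0)" "perimeter G \<nu> d S0 < 1"
    by (auto simp: separating_cuts_ge_1_def not_le)
  obtain S where S: "s \<in> S" "t \<notin> S" "perimeter G \<nu> d S < 1"
  proof (cases "s \<in> S0")
    case True
    then show thesis using S0 that[of S0] by blast
  next
    case False
    then show thesis using S0 that[of "pverts G - S0"] s_in by (simp add: perimeter_compl)
  qed
  define p where "p = perimeter G \<nu> d S"
  have p: "0 \<le> p" "p < 1" using S perimeter_nonneg by (auto simp: p_def)
  obtain A0 where A0: "A0 \<subseteq> pverts (GP 1)" "inner_mass 1 A0 > 0" "inner_mass 1 (- A0) > 0"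
    using set_with_inner_and_outer_mass[OF card] by blast
  define R where "R = perimeter (GP 1) (\<nu>P 1) (dP 1) A0"
  define k where "k = min (inner_mass 1 A0) (inner_mass 1 (- A0))"
  have k: "k > 0" using A0 by (simp add: k_def)
  \<comment> \<open>\<open>A0\<close> lives in \<open>GP 1\<close>, so after \<open>n\<close>
    refinements the set lives in \<open>GP (Suc n)\<close>.\<close>
  have ex: "\<exists>A\<subseteq>pverts (GP (Suc n)). perimeter (GP (Suc n)) (\<nu>P (Suc n)) (dP (Suc n)) A = p ^ n * R \<and>
    k \<le> inner_mass (Suc n) A \<and> k \<le> inner_mass (Suc n) (- A)" for n
  proof (induction n)
    case 0
    then show ?case using A0(1) by (intro exI[of _ A0]) (simp add: R_def k_def del: oslash_power.simps measure_power.simps metric_power.simps)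
  next
    case (Suc n)
    then obtain A where A: "perimeter (GP (Suc n)) (\<nu>P (Suc n)) (dP (Suc n)) A = p ^ n * R"
      "k \<le> inner_mass (Suc n) A" "k \<le> inner_mass (Suc n) (- A)" by blast
    obtain A' where "A' \<subseteq> pverts (GP (Suc (Suc n)))"
      "perimeter (GP (Suc (Suc n))) (\<nu>P (Suc (Suc n))) (dP (Suc (Suc n))) A' =
        p * perimeter (GP (Suc n)) (\<nu>P (Suc n)) (dP (Suc n)) A"
      "inner_mass (Suc n) A \<le> inner_mass (Suc (Suc n)) A'"
      "inner_mass (Suc n) (- A) \<le> inner_mass (Suc (Suc n)) (- A')"
      unfolding p_def using refine_set[OF S(1,2)] by blast
    with A show ?case by (intro exI[of _ A'] conjI) (simp_all only: power_Suc mult.assoc order_trans)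
  qed
  define \<theta> where "\<theta> = (\<delta> - 1) / \<delta>"
  have \<delta>: "1 \<le> \<delta>"
    using iso by (simp add: power_has_isoperimetric_dimension_def has_isoperimetric_dimension_def)
  have "k powr \<theta> \<le> C * (p ^ n * R)" for n
  proof -
    obtain A where A: "A \<subseteq> pverts (GP (Suc n))"
      "perimeter (GP (Suc n)) (\<nu>P (Suc n)) (dP (Suc n)) A = p ^ n * R"
      "k \<le> inner_mass (Suc n) A" "k \<le> inner_mass (Suc n) (- A)"
      using ex by blast
    let ?\<mu> = "vertex_measure (GP (Suc n)) (\<nu>P (Suc n))"
    have "k \<le> sum ?\<mu> A" using A(3) inner_mass_le[OF A(1)] by simp
    moreover have "k \<le> sum ?\<mu> (pverts (GP (Suc n)) - A)"
      using A(4) inner_mass_le[of "pverts (GP (Suc n)) - A" "Suc n"] inner_mass_compl[of "Suc n" A] by simp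
    ultimately have "k powr \<theta> \<le> min (sum ?\<mu> A) (sum ?\<mu> (pverts (GP (Suc n)) - A)) powr \<theta>"
      using k \<delta> by (intro powr_mono2) (auto simp: \<theta>_def)
    also have "\<dots> \<le> C * perimeter (GP (Suc n)) (\<nu>P (Suc n)) (dP (Suc n)) A"
      using iso[of "Suc n"] A(1)
      unfolding power_has_isoperimetric_dimension_def has_isoperimetric_dimension_def \<theta>_def by blast
    finally show ?thesis by (simp only: A(2))
  qed
  \<comment> \<open>The right-hand side tends to 0 since p < 1, while \<open>k powr \<theta>\<close>
    is a fixed positive number.\<close>
  moreover have "(\<lambda>n. C * (p ^ n * R)) \<longlonglongrightarrow> C * (0 * R)"
    by (intro tendsto_intros LIMSEQ_realpow_zero p)
  ultimately have "k powr \<theta> \<le> C * (0 * R)"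
    by (intro LIMSEQ_le_const) auto
  with k show False by simp
qed

section \<open>The equivalence\<close>

lemma perimeter_Min_iff:
  "1 \<le> Min {perimeter G \<nu> d S | S. S \<subseteq> pverts G \<and> card (S \<inter> {s, t}) = 1} \<longleftrightarrow> separating_cuts_ge_1"
proof -
  have card: "card (S \<inter> {s, t}) = 1 \<longleftrightarrow> (s \<in> S) \<noteq> (t \<in> S)" for S
    using s_neq_t by (auto simp: Int_insert_right card_insert_if)
  let ?P = "{perimeter G \<nu> d S | S. S \<subseteq> pverts G \<and> (s \<in> S) \<noteq> (t \<in> S)}"
  have "?P \<subseteq> perimeter G \<nu> d ` Pow (pverts G)" by auto
  then have "finite ?P" by (rule finite_subset) (simp add: finite_G)
  moreover have "perimeter G \<nu> d {s} \<in> ?P" using s_in s_neq_t by auto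
  then have "?P \<noteq> {}" by blast
  ultimately have "1 \<le> Min ?P \<longleftrightarrow> (\<forall>x\<in>?P. 1 \<le> x)" by (rule Min_ge_iff)
  then show ?thesis unfolding card separating_cuts_ge_1_def by blast
qed

lemma perimeter_power_nonneg: "perimeter (GP n) (\<nu>P n) (dP n) A \<ge> 0"
  unfolding perimeter_power by (rule cut_perimeter_nonneg)

text \<open>Statement 1 allows a different constant for each power. Raising all of them to their
  common bound yields the uniform constant of statement 2.\<close>

lemma power_has_isoperimetric_dimension_mono:
  assumes "power_has_isoperimetric_dimension G s t \<nu> d n \<delta> C" "C \<le> C'"
  shows "power_has_isoperimetric_dimension G s t \<nu> d n \<delta> C'"
  using assms mult_right_mono[OF assms(2) perimeter_power_nonneg]
  unfolding power_has_isoperimetric_dimension_def has_isoperimetric_dimension_def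
  by (meson order_trans less_le_trans)

end

theorem corollary1:
  fixes G :: "'a pair_pre_digraph" and s t :: 'a
    and d :: "'a \<Rightarrow> 'a \<Rightarrow> real" and \<nu> :: "'a \<times> 'a \<Rightarrow> real"
  assumes "st_graph G s t"
    and "card (pverts G) > 2"
    and "geodesic_metric G d"
    and "d s t = 1"
    and "full_prob_measure (parcs G) \<nu>"
    and "\<forall>(u, v)\<in>parcs G. d u v \<noteq> 1" (* no division by zero in the formula for the dimension *)
  shows
    "((\<forall>n. \<exists>C.
         C \<le> Max {inverse (perimeter G \<nu> d S) | S. S \<noteq> {} \<and> S \<subset> pverts G} \<and>
         power_has_isoperimetric_dimension G s t \<nu> d n
           (Max ((\<lambda>(u, v). ln (\<nu> (u, v)) / ln (d u v)) ` parcs G)) C)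
      \<longleftrightarrow>
      (\<exists>\<delta> C. \<forall>n. power_has_isoperimetric_dimension G s t \<nu> d n \<delta> C))
     \<and>
     ((\<exists>\<delta> C. \<forall>n. power_has_isoperimetric_dimension G s t \<nu> d n \<delta> C)
      \<longleftrightarrow>
      Min {perimeter G \<nu> d S | S. S \<subseteq> pverts G \<and> card (S \<inter> {s, t}) = 1} \<ge> 1)"
proof -
  have G: "pair_digraph G" "s \<in> pverts G" "t \<in> pverts G" "s \<noteq> t"
    using assms(1) by (auto simp: st_graph_def simple_graph_def)
  interpret G: pair_digraph G by (rule G(1))
  have "metric_host G d"
    using G.pair_finite_verts G.pair_finite_arcs G.pair_no_loops assms(3)
    unfolding metric_host_def by (auto dest: G.in_arcsD1 G.in_arcsD2)
  then interpret weighted_st_graph G s t d \<nu>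
    using assms(4-6) G by unfold_locales (auto simp: full_prob_measure_def)
  let ?M = max_inverse_perimeter and ?iso = "power_has_isoperimetric_dimension G s t \<nu> d"
  have "\<exists>\<delta> C. \<forall>n. ?iso n \<delta> C" if "\<forall>n. \<exists>C. C \<le> ?M \<and> ?iso n max_exponent C"
    using that power_has_isoperimetric_dimension_mono by blast
  moreover have separating_cuts_ge_1 if "\<exists>\<delta> C. \<forall>n. ?iso n \<delta> C"
    using that isoperimetric_imp_separating_cuts[OF assms(2)] by blast
  moreover have "\<forall>n. \<exists>C. C \<le> ?M \<and> ?iso n max_exponent C" if separating_cuts_ge_1
    using separating_cuts_imp_isoperimetric[OF that] by blast
  ultimately show ?thesis
    unfolding max_exponent_def[symmetric] max_inverse_perimeter_def[symmetric] perimeter_Min_iff by blast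
qed

end
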